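(* Let $G$ be a connected graph on $n\geq 14$ vertices with minimum degree $\delta\geq 3$. If $$\rho(G)\geq \rho(S_{n}^{3}),$$ then $G$ is Hamilton-connected unless $G=S_{n}^{3}$.
   Context: All graphs are finite and simple (no loops or multiple edges); equality of graphs is up to isomorphism. $\delta=\delta(G)$ is the minimum degree of $G$. $\rho(G)$ is the spectral radius of $G$, i.e. the largest eigenvalue of its adjacency matrix $A(G)$. A Hamilton path is a path containing all vertices of $G$; $G$ is Hamilton-connected if every two (distinct) vertices of $G$ are connected by a Hamilton path. $G+H$ and $G\vee H$ denote the disjoint union and the join of $G$ and $H$; $kG$ is the disjoint union of $k$ copies of $G$; $K_n$ is the complete graph on $n$ vertices. The graph $S_n^3$ is $$S_{n}^{3}=K_{3}\vee (K_{n-5}+2K_{1}).$$ *)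

theory Defs
  imports
    "Graph_Theory.Graph_Theory"
    "Jordan_Normal_Form.Spectral_Radius"
begin

text \<open>
  A finite simple graph is a \<open>pair_graph\<close> of the entry Graph_Theory: a finite vertex set with a
  finite, irreflexive and symmetric arc relation, the two arcs \<open>(u, v)\<close> and \<open>(v, u)\<close> together
  representing the edge \<open>uv\<close>. In particular the out-degree of a vertex is its degree.
\<close>

definition min_degree :: "'a pair_pre_digraph \<Rightarrow> nat" where
  "min_degree G = Min (out_degree (with_proj G) ` pverts G)"

definition vertex_enum :: "'a pair_pre_digraph \<Rightarrow> 'a list" where
  "vertex_enum G = (SOME vs. distinct vs \<and> set vs = pverts G)"

text \<open>
  Matrices are indexed by natural numbers, so the vertices have to be listed in some order. The
  eigenvalues do not depend on it: two orders give matrices that are similar by a permutation.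
\<close>

definition adjacency_matrix :: "'a pair_pre_digraph \<Rightarrow> real mat" where
  "adjacency_matrix G =
     (let vs = vertex_enum G; n = card (pverts G)
      in mat n n (\<lambda>(i, j). if (vs ! i, vs ! j) \<in> parcs G then 1 else 0))"

text \<open>
  The largest real eigenvalue; all eigenvalues are real, as the matrix is symmetric. The constant
  \<open>spectral_radius\<close> of the entry Jordan_Normal_Form, for complex matrices, is the maximum modulus.
\<close>

definition graph_spectral_radius :: "'a pair_pre_digraph \<Rightarrow> real" where
  "graph_spectral_radius G = Max (spectrum (adjacency_matrix G))"

definition hamilton_path :: "'a pair_pre_digraph \<Rightarrow> 'a \<Rightarrow> 'a list \<Rightarrow> 'a \<Rightarrow> bool" where
  "hamilton_path G u p v \<longleftrightarrow>
     vpath p (with_proj G) \<and> hd p = u \<and> last p = v \<and> set p = pverts G"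

definition hamilton_connected :: "'a pair_pre_digraph \<Rightarrow> bool" where
  "hamilton_connected G \<longleftrightarrow>
     (\<forall>u \<in> pverts G. \<forall>v \<in> pverts G. u \<noteq> v \<longrightarrow> (\<exists>p. hamilton_path G u p v))"

definition graph_iso :: "'a pair_pre_digraph \<Rightarrow> 'b pair_pre_digraph \<Rightarrow> bool" where
  "graph_iso G H \<longleftrightarrow> digraph_iso (with_proj G) (with_proj H)"

definition complete_graph :: "nat \<Rightarrow> nat pair_pre_digraph" where
  "complete_graph n = \<lparr> pverts = {..<n}, parcs = {(u, v). u < n \<and> v < n \<and> u \<noteq> v} \<rparr>"

definition disjoint_union ::
  "'a pair_pre_digraph \<Rightarrow> 'b pair_pre_digraph \<Rightarrow> ('a + 'b) pair_pre_digraph" where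
  "disjoint_union G H = \<lparr> pverts = pverts G <+> pverts H,
     parcs = map_prod Inl Inl ` parcs G \<union> map_prod Inr Inr ` parcs H \<rparr>"

definition join ::
  "'a pair_pre_digraph \<Rightarrow> 'b pair_pre_digraph \<Rightarrow> ('a + 'b) pair_pre_digraph" where
  "join G H = \<lparr> pverts = pverts G <+> pverts H,
     parcs = parcs (disjoint_union G H) \<union>
       (Inl ` pverts G) \<times> (Inr ` pverts H) \<union> (Inr ` pverts H) \<times> (Inl ` pverts G) \<rparr>"

definition copies :: "nat \<Rightarrow> 'a pair_pre_digraph \<Rightarrow> (nat \<times> 'a) pair_pre_digraph" where
  "copies k G = \<lparr> pverts = {..<k} \<times> pverts G,
     parcs = {((i, u), (j, v)). i < k \<and> i = j \<and> (u, v) \<in> parcs G} \<rparr>"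

definition S3 :: "nat \<Rightarrow> (nat + nat + nat \<times> nat) pair_pre_digraph" where
  "S3 n = join (complete_graph 3)
            (disjoint_union (complete_graph (n - 5)) (copies 2 (complete_graph 1)))"

lemma pair_graph_iff:
  "pair_graph G \<longleftrightarrow> finite (pverts G) \<and> parcs G \<subseteq> pverts G \<times> pverts G \<and> irrefl (parcs G) \<and> sym (parcs G)"
proof
  assume "pair_graph G"
  then interpret pair_graph G .
  show "finite (pverts G) \<and> parcs G \<subseteq> pverts G \<times> pverts G \<and> irrefl (parcs G) \<and> sym (parcs G)"
    using pair_finite_verts pair_sym_arcs
    by (auto simp: irrefl_def symmetric_def dest: in_arcsD1 in_arcsD2 no_loops')
next
  assume *: "finite (pverts G) \<and> parcs G \<subseteq> pverts G \<times> pverts G \<and> irrefl (parcs G) \<and> sym (parcs G)"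
  then have "finite (parcs G)"
    by (meson finite_SigmaI finite_subset)
  with * show "pair_graph G"
    by unfold_locales (auto simp: irrefl_def symmetric_def)
qed

lemma pair_graph_complete_graph: "pair_graph (complete_graph n)"
  by (auto simp: pair_graph_iff complete_graph_def irrefl_def sym_def)

lemma pair_graph_disjoint_union:
  assumes "pair_graph G" "pair_graph H"
  shows "pair_graph (disjoint_union G H)"
  using assms unfolding pair_graph_iff disjoint_union_def irrefl_def sym_def
  by auto

lemma pair_graph_join:
  assumes "pair_graph G" "pair_graph H"
  shows "pair_graph (join G H)"
  using assms unfolding pair_graph_iff join_def disjoint_union_def irrefl_def sym_def
  by auto

lemma pair_graph_copies: "pair_graph G \<Longrightarrow> pair_graph (copies k G)"
  by (auto simp: pair_graph_iff copies_def irrefl_def sym_def)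

lemma pair_graph_S3: "pair_graph (S3 n)"
  by (simp add: S3_def pair_graph_join pair_graph_disjoint_union pair_graph_copies
      pair_graph_complete_graph)

lemma card_pverts_S3:
  assumes "n \<ge> 5"
  shows "card (pverts (S3 n)) = n"
  using assms
  by (simp add: S3_def join_def disjoint_union_def copies_def complete_graph_def card_Plus)

end

theory Submission
  imports Defs "HOL-Analysis.Function_Topology"
begin

text \<open>
  Write \<open>S\<close> for the exceptional graph \<open>K\<^sub>3 \<or> (K\<^sub>n\<^sub>-\<^sub>5 + 2K\<^sub>1)\<close> and \<open>\<rho>\<close> for the largest eigenvalue of \<open>G\<close>.
  As \<open>S\<close> properly contains \<open>K\<^sub>n\<^sub>-\<^sub>2\<close>, the hypothesis gives \<open>\<rho> > n - 3\<close>.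

  A spectral radius this large forces many edges. Pairing the Perron vector with the row sums of
  \<open>A\<^sup>2 - (\<delta> - 1) A\<close> gives \<open>\<rho>\<^sup>2 - (\<delta> - 1) \<rho> \<le> 2m - \<delta> (n - 1)\<close> (\<open>eigenvalue_edge_bound\<close>). For \<open>\<delta> = 3\<close>,
  and because a degree sum is even, the degree sum is at least \<open>n\<^sup>2 - 5n + 14\<close>, which is only \<open>4\<close> less
  than that of \<open>S\<close>.

  Suppose that two vertices are not joined by a Hamilton path. Adding edges as long as this remains
  so gives a graph \<open>H \<supseteq> G\<close> on the same vertices in which non-adjacent vertices have degree sum at most
  \<open>n\<close> (\<open>saturated_supergraph\<close>). A non-adjacent pair of largest degree sum, whose smaller degree is
  \<open>k\<close>, then yields \<open>k - 1\<close> vertices of degree at most \<open>k\<close> and \<open>n - k\<close> vertices of degree at most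
  \<open>n - k\<close>. The resulting bound on the degree sum contradicts the lower bound unless \<open>k = 3\<close>, or
  \<open>n = 14\<close> and \<open>k = 7\<close> with equality everywhere (\<open>dense_nonadjacent_low_degrees\<close>). In the second case
  all degrees of \<open>G\<close> are at least \<open>7\<close>, and the edge bound with \<open>\<delta> = 7\<close> contradicts \<open>\<rho> > 11\<close>.

  For \<open>k = 3\<close> there are two vertices \<open>u\<close>, \<open>w\<close> of degree three in \<open>H\<close>, all other vertices form a clique,
  and \<open>u\<close>, \<open>w\<close> have the same further neighbours. If they are not adjacent, \<open>G\<close> is a spanning subgraph
  of \<open>S\<close>; a proper one has a smaller spectral radius, so \<open>G\<close> is \<open>S\<close> (\<open>arcs_eq_extremal\<close>). If they are
  adjacent, \<open>G\<close> lies in \<open>K\<^sub>2 \<or> (K\<^sub>n\<^sub>-\<^sub>4 + K\<^sub>2)\<close>. This graph is not a subgraph of \<open>S\<close> and has just one edge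
  less, so counting edges does not exclude it. Instead, the Perron vector is used as a test vector for
  the copy of \<open>S\<close> in which the edge \<open>uw\<close> is traded for two edges \<open>uc\<close>, \<open>wc\<close> (\<open>no_attached_edge\<close>).
\<close>

section \<open>The largest eigenvalue as a maximum of the quadratic form\<close>

text \<open>
  Vertex set and arc relation are kept as separate parameters because the proof compares several arc
  relations on one vertex set: that of \<open>G\<close>, its extensions by edges, and copies of the extremal graph.
\<close>

locale simple_graph =
  fixes V :: "'a set" and E :: "('a \<times> 'a) set"
  assumes finite_V: "finite V"
    and E_subset: "E \<subseteq> V \<times> V"
    and irrefl_E: "irrefl E"
    and sym_E: "sym E"
begin

lemma finite_E: "finite E"
  using E_subset finite_V by (meson finite_SigmaI finite_subset)

lemma not_loop [simp]: "(v, v) \<notin> E"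
  using irrefl_E by (simp add: irrefl_def)

lemma arc_sym: "(v, w) \<in> E \<Longrightarrow> (w, v) \<in> E"
  using sym_E by (rule symD)

lemma nbhd_subset: "E `` {v} \<subseteq> V"
  using E_subset by auto

lemma finite_nbhd: "finite (E `` {v})"
  using nbhd_subset finite_V by (rule finite_subset)

definition deg :: "'a \<Rightarrow> nat" where
  "deg v = card (E `` {v})"

definition adj_form :: "('a \<Rightarrow> real) \<Rightarrow> ('a \<Rightarrow> real) \<Rightarrow> real" where
  "adj_form f g = (\<Sum>e\<in>E. f (fst e) * g (snd e))"

definition adj_sum :: "('a \<Rightarrow> real) \<Rightarrow> 'a \<Rightarrow> real" where
  "adj_sum f v = (\<Sum>w\<in>E `` {v}. f w)"

lemma sum_arcs: "(\<Sum>e\<in>E. h (fst e) (snd e)) = (\<Sum>v\<in>V. \<Sum>w\<in>E `` {v}. h v w :: real)"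
proof -
  have "E = (SIGMA v:V. E `` {v})" using E_subset by auto
  then have "(\<Sum>e\<in>E. h (fst e) (snd e)) = (\<Sum>e\<in>(SIGMA v:V. E `` {v}). h (fst e) (snd e))"
    by simp
  also have "\<dots> = (\<Sum>v\<in>V. \<Sum>w\<in>E `` {v}. h v w)"
    by (subst sum.Sigma) (auto simp: finite_V finite_nbhd case_prod_beta)
  finally show ?thesis .
qed

lemma adj_form_eq: "adj_form f g = (\<Sum>v\<in>V. f v * adj_sum g v)"
  unfolding adj_form_def adj_sum_def by (subst sum_arcs) (simp add: sum_distrib_left)

lemma sum_arcs_swap: "(\<Sum>e\<in>E. h (fst e) (snd e)) = (\<Sum>e\<in>E. h (snd e) (fst e) :: real)"
  by (rule sum.reindex_bij_witness[of _ prod.swap prod.swap]) (auto dest: arc_sym)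

lemma adj_form_commute: "adj_form f g = adj_form g f"
  unfolding adj_form_def by (subst sum_arcs_swap) (simp add: mult.commute)

lemma adj_form_add_scaled:
  "adj_form (\<lambda>v. f v + t * g v) (\<lambda>v. f v + t * g v)
    = adj_form f f + 2 * t * adj_form g f + t\<^sup>2 * adj_form g g"
proof -
  have "adj_form (\<lambda>v. f v + t * g v) (\<lambda>v. f v + t * g v)
    = adj_form f f + t * adj_form f g + t * adj_form g f + t\<^sup>2 * adj_form g g"
    unfolding adj_form_def sum_distrib_left sum.distrib[symmetric]
    by (rule sum.cong) (auto simp: algebra_simps power2_eq_square)
  then show ?thesis using adj_form_commute[of f g] by simp
qed

text \<open>
  The vertex set is an arbitrary finite set rather than a type, so the functions on it are modelled as
  total functions vanishing elsewhere. They form a closed subset of a product of compact sets, of which all but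
  finitely many factors are points.
\<close>

lemma compact_nonneg_sphere:
  "compact {f :: 'a \<Rightarrow> real. (\<forall>v\<in>V. 0 \<le> f v) \<and> (\<forall>v. v \<notin> V \<longrightarrow> f v = 0) \<and> (\<Sum>v\<in>V. (f v)\<^sup>2) = 1}"
    (is "compact ?K")
proof -
  define B where "B = (PiE UNIV (\<lambda>v. if v \<in> V then {0..1} else {0}) :: ('a \<Rightarrow> real) set)"
  have "compactin (product_topology (\<lambda>i. euclidean) UNIV) B"
    unfolding B_def by (subst compactin_PiE) auto
  then have "compact B"
    by (simp add: euclidean_product_topology)
  moreover have "closed {f :: 'a \<Rightarrow> real. (\<Sum>v\<in>V. (f v)\<^sup>2) = 1}"
    by (intro closed_Collect_eq continuous_intros continuous_on_product_coordinates)
  ultimately have "compact (B \<inter> {f. (\<Sum>v\<in>V. (f v)\<^sup>2) = 1})"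
    by (rule compact_Int_closed)
  moreover have "B \<inter> {f. (\<Sum>v\<in>V. (f v)\<^sup>2) = 1} = ?K"
  proof -
    have "f v \<le> 1" if "(\<Sum>v\<in>V. (f v)\<^sup>2) = 1" "v \<in> V" for f :: "'a \<Rightarrow> real" and v
    proof -
      have "(f v)\<^sup>2 \<le> 1"
        using that member_le_sum[of v V "\<lambda>v. (f v)\<^sup>2"] finite_V by auto
      then show ?thesis
        by (simp add: abs_square_le_1)
    qed
    then show ?thesis
      unfolding B_def by (auto simp: PiE_iff split: if_splits)
  qed
  ultimately show ?thesis by simp
qed

text \<open>
  Maximise the quadratic form over the non-negative unit sphere. Passing from \<open>f\<close> to its absolute value
  does not decrease the form, so the value found bounds the Rayleigh quotient of every function; and a
  function at which the quotient is maximal is an eigenvector, by varying it in the direction of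
  the residual \<open>A x - \<mu> x\<close>.
\<close>

lemma perron_rayleigh:
  assumes "V \<noteq> {}"
  obtains \<mu> x where "\<And>v. 0 \<le> x v" "\<exists>v\<in>V. x v \<noteq> 0"
    and "\<And>v. v \<in> V \<Longrightarrow> adj_sum x v = \<mu> * x v"
    and "\<And>f. adj_form f f \<le> \<mu> * (\<Sum>v\<in>V. (f v)\<^sup>2)"
proof -
  define K where "K = {f :: 'a \<Rightarrow> real. (\<forall>v\<in>V. 0 \<le> f v) \<and> (\<forall>v. v \<notin> V \<longrightarrow> f v = 0) \<and> (\<Sum>v\<in>V. (f v)\<^sup>2) = 1}"
  obtain v0 where "v0 \<in> V" using assms by auto
  then have "(\<lambda>v. if v = v0 then 1 else 0) \<in> K"
    unfolding K_def using finite_V by (auto simp: if_distrib[of "\<lambda>x. x\<^sup>2"] cong: if_cong)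
  then have "K \<noteq> {}" by auto
  moreover have "continuous_on K (\<lambda>f. adj_form f f)"
    unfolding adj_form_def
    by (intro continuous_intros continuous_on_subset[OF continuous_on_product_coordinates]) auto
  ultimately obtain x where x: "x \<in> K" and max: "\<And>f. f \<in> K \<Longrightarrow> adj_form f f \<le> adj_form x x"
    using continuous_attains_sup[of K "\<lambda>f. adj_form f f"] compact_nonneg_sphere
    unfolding K_def by blast
  define \<mu> where "\<mu> = adj_form x x"
  have sumx: "(\<Sum>v\<in>V. (x v)\<^sup>2) = 1" using x by (simp add: K_def)
  have ray: "adj_form f f \<le> \<mu> * (\<Sum>v\<in>V. (f v)\<^sup>2)" for f
  proof (cases "(\<Sum>v\<in>V. (f v)\<^sup>2) = 0")
    case True
    then have "\<forall>v\<in>V. f v = 0" using finite_V by (simp add: sum_nonneg_eq_0_iff)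
    then have "adj_form f f = 0" unfolding adj_form_eq by simp
    then show ?thesis using True by simp
  next
    case False
    define s where "s = (\<Sum>v\<in>V. (f v)\<^sup>2)"
    have s: "s > 0" using False unfolding s_def by (simp add: order_less_le sum_nonneg)
    define g where "g v = (if v \<in> V then \<bar>f v\<bar> / sqrt s else 0)" for v
    have g2: "(g v)\<^sup>2 = (f v)\<^sup>2 / s" if "v \<in> V" for v
      using that s by (simp add: g_def power_divide)
    then have "(\<Sum>v\<in>V. (g v)\<^sup>2) = 1"
      using s by (simp add: sum_divide_distrib[symmetric] s_def)
    then have "g \<in> K" using s by (auto simp: K_def g_def)
    have "adj_form f f \<le> (\<Sum>e\<in>E. s * (g (fst e) * g (snd e)))"
      unfolding adj_form_def
    proof (rule sum_mono)
      fix e assume "e \<in> E"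
      then have "fst e \<in> V" "snd e \<in> V" using E_subset by auto
      then have "s * (g (fst e) * g (snd e)) = \<bar>f (fst e)\<bar> * \<bar>f (snd e)\<bar>"
        using s by (simp add: g_def)
      also have "\<dots> \<ge> f (fst e) * f (snd e)" by (simp add: abs_mult[symmetric])
      finally show "f (fst e) * f (snd e) \<le> s * (g (fst e) * g (snd e))" .
    qed
    also have "\<dots> = s * adj_form g g" unfolding adj_form_def by (simp add: sum_distrib_left)
    also have "\<dots> \<le> s * \<mu>" using s max[OF \<open>g \<in> K\<close>] by (simp add: \<mu>_def)
    finally show ?thesis by (simp add: s_def mult.commute)
  qed
  define r where "r v = adj_sum x v - \<mu> * x v" for v
  define s where "s = (\<Sum>v\<in>V. (r v)\<^sup>2)"
  have "s = 0"
  proof -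
    define c where "c = adj_form r r - \<mu> * s"
    have s_eq: "s = adj_form r x - \<mu> * (\<Sum>v\<in>V. r v * x v)"
      unfolding s_def adj_form_eq sum_distrib_left sum_subtractf[symmetric]
      by (rule sum.cong) (auto simp: r_def power2_eq_square algebra_simps)
    have var: "2 * t * s + t\<^sup>2 * c \<le> 0" for t
    proof -
      have "adj_form x x + 2 * t * adj_form r x + t\<^sup>2 * adj_form r r
          \<le> \<mu> * (\<Sum>v\<in>V. (x v + t * r v)\<^sup>2)"
        using ray[of "\<lambda>v. x v + t * r v"] by (simp only: adj_form_add_scaled)
      also have "(\<Sum>v\<in>V. (x v + t * r v)\<^sup>2) = 1 + 2 * t * (\<Sum>v\<in>V. r v * x v) + t\<^sup>2 * s"
        unfolding s_def sumx[symmetric] sum_distrib_left sum.distrib[symmetric]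
        by (rule sum.cong) (auto simp: power2_eq_square algebra_simps)
      finally show ?thesis
        using arg_cong[OF s_eq, of "\<lambda>z. 2 * t * z"]
        by (simp add: \<mu>_def[symmetric] c_def algebra_simps)
    qed
    have "s \<ge> 0" unfolding s_def by (simp add: sum_nonneg)
    \<comment> \<open>The quadratic polynomial in \<open>t\<close> is non-positive everywhere, so its linear coefficient vanishes;
      this \<open>t\<close> is small enough for the linear term to dominate.\<close>
    define t where "t = s / (1 + \<bar>c\<bar>)"
    have p: "1 + \<bar>c\<bar> > 0" by simp
    have "s = t * (1 + \<bar>c\<bar>)" using p by (simp add: t_def)
    then have "2 * t * s + t\<^sup>2 * c = t\<^sup>2 * (2 + 2 * \<bar>c\<bar> + c)"
      by (simp add: power2_eq_square algebra_simps)
    with var[of t] have "t\<^sup>2 * (2 + 2 * \<bar>c\<bar> + c) \<le> 0" by simp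
    moreover have "2 + 2 * \<bar>c\<bar> + c > 0" by linarith
    ultimately have "t = 0" by (simp add: mult_le_0_iff)
    then show "s = 0" using p by (simp add: t_def)
  qed
  then have "adj_sum x v = \<mu> * x v" if "v \<in> V" for v
    using that finite_V by (simp add: s_def sum_nonneg_eq_0_iff r_def)
  moreover have "\<exists>v\<in>V. x v \<noteq> 0"
    using sumx by (metis (mono_tags, lifting) sum.neutral zero_neq_one zero_power2)
  moreover have "0 \<le> x v" for v using x unfolding K_def by (cases "v \<in> V") auto
  ultimately show thesis using ray that by blast
qed

text \<open>
  If an entry is positive then so is the sum over the neighbourhood of each adjacent vertex, hence by
  the eigenvalue equation the entry there.
\<close>

lemma eigenvector_pos:
  assumes eig: "\<And>v. v \<in> V \<Longrightarrow> adj_sum x v = \<mu> * x v"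
    and nonneg: "\<And>v. 0 \<le> x v" and v0: "v0 \<in> V" "x v0 \<noteq> 0"
    and conn: "\<And>v. v \<in> V \<Longrightarrow> (v0, v) \<in> E\<^sup>*"
    and v: "v \<in> V"
  shows "0 < x v"
proof -
  have "(v0, v) \<in> E\<^sup>*" using conn v .
  then show ?thesis
  proof (induction rule: rtrancl_induct)
    case base
    then show ?case using nonneg[of v0] v0 by simp
  next
    case (step y z)
    then have z: "z \<in> V" and yz: "y \<in> E `` {z}" using E_subset arc_sym by auto
    have "x y \<le> adj_sum x z" unfolding adj_sum_def
      using yz finite_nbhd nonneg by (intro member_le_sum) auto
    then have "x z \<noteq> 0" using step.IH eig[OF z] by auto
    then show ?case using nonneg[of z] by simp
  qed
qed

end

lemma simple_graphI: "pair_graph G \<Longrightarrow> simple_graph (pverts G) (parcs G)"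
  by (simp add: pair_graph_iff simple_graph_def)

lemma vertex_enum:
  assumes "finite (pverts G)"
  shows "distinct (vertex_enum G)" "set (vertex_enum G) = pverts G"
proof -
  have "\<exists>vs. distinct vs \<and> set vs = pverts G"
    using finite_distinct_list[OF assms] by blast
  then have "distinct (vertex_enum G) \<and> set (vertex_enum G) = pverts G"
    unfolding vertex_enum_def by (rule someI_ex)
  then show "distinct (vertex_enum G)" "set (vertex_enum G) = pverts G" by auto
qed

text \<open>
  The enumeration of the vertices only relabels coordinates, so vectors may be replaced by functions on
  the vertex set, which do not depend on an order.
\<close>

lemma eigenvalue_adjacency_matrix_iff:
  assumes G: "pair_graph G"
  shows "eigenvalue (adjacency_matrix G) \<theta> \<longleftrightarrow>
    (\<exists>f. (\<exists>v\<in>pverts G. f v \<noteq> 0) \<and>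
      (\<forall>v\<in>pverts G. simple_graph.adj_sum (parcs G) f v = \<theta> * f v))"
proof -
  interpret simple_graph "pverts G" "parcs G" by (rule simple_graphI[OF G])
  define vs where "vs = vertex_enum G"
  define n where "n = card (pverts G)"
  have vs: "distinct vs" "set vs = pverts G"
    using vertex_enum[OF finite_V] by (auto simp: vs_def)
  then have len: "length vs = n" by (metis distinct_card n_def)
  have bij: "bij_betw ((!) vs) {0..<n} (pverts G)"
    using bij_betw_nth[OF vs(1), of "{0..<n}" "pverts G"] vs len by (simp add: atLeast0LessThan)
  define A where "A = mat n n (\<lambda>(i, j). if (vs ! i, vs ! j) \<in> parcs G then 1 else 0 :: real)"
  have A: "adjacency_matrix G = A"
    unfolding adjacency_matrix_def A_def by (simp add: Let_def vs_def n_def)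
  have row: "(A *\<^sub>v u) $ i = adj_sum f (vs ! i)"
    if "i < n" and u: "u \<in> carrier_vec n" and f: "\<And>j. j < n \<Longrightarrow> u $ j = f (vs ! j)" for u i f
  proof -
    have "(A *\<^sub>v u) $ i = (\<Sum>j = 0..<n. (if (vs ! i, vs ! j) \<in> parcs G then 1 else 0) * u $ j)"
      using that by (simp add: A_def scalar_prod_def)
    also have "\<dots> = (\<Sum>j = 0..<n. if (vs ! i, vs ! j) \<in> parcs G then f (vs ! j) else 0)"
      by (rule sum.cong) (auto simp: f)
    also have "\<dots> = (\<Sum>w\<in>pverts G. if (vs ! i, w) \<in> parcs G then f w else 0)"
      by (rule sum.reindex_bij_betw[OF bij])
    also have "\<dots> = adj_sum f (vs ! i)"
      unfolding adj_sum_def using nbhd_subset finite_V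
      by (intro sum.mono_neutral_cong_right) auto
    finally show ?thesis .
  qed
  show ?thesis
  proof
    assume "eigenvalue (adjacency_matrix G) \<theta>"
    then obtain u where u: "u \<in> carrier_vec n" "u \<noteq> 0\<^sub>v n" "A *\<^sub>v u = \<theta> \<cdot>\<^sub>v u"
      unfolding A eigenvalue_def eigenvector_def by (auto simp: A_def)
    define f where "f w = u $ (inv_into {0..<n} ((!) vs) w)" for w
    have f: "u $ j = f (vs ! j)" if "j < n" for j
      using that bij unfolding f_def by (simp add: bij_betw_def inv_into_f_f)
    have "\<exists>i<n. u $ i \<noteq> 0"
      using u(1,2) by (metis carrier_vecD eq_vecI index_zero_vec)
    then have "\<exists>v\<in>pverts G. f v \<noteq> 0"
      using f len vs(2) by (metis nth_mem)
    moreover have "adj_sum f v = \<theta> * f v" if v: "v \<in> pverts G" for v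
    proof -
      obtain i where i: "i < n" "v = vs ! i" using v unfolding vs(2)[symmetric] in_set_conv_nth len by auto
      have "adj_sum f v = (\<theta> \<cdot>\<^sub>v u) $ i" using row[OF i(1) u(1) f] u(3) i by simp
      also have "\<dots> = \<theta> * f v" using i u(1) f by simp
      finally show ?thesis .
    qed
    ultimately show "\<exists>f. (\<exists>v\<in>pverts G. f v \<noteq> 0) \<and> (\<forall>v\<in>pverts G. adj_sum f v = \<theta> * f v)" by blast
  next
    assume "\<exists>f. (\<exists>v\<in>pverts G. f v \<noteq> 0) \<and> (\<forall>v\<in>pverts G. adj_sum f v = \<theta> * f v)"
    then obtain f where f: "\<exists>v\<in>pverts G. f v \<noteq> 0" "\<And>v. v \<in> pverts G \<Longrightarrow> adj_sum f v = \<theta> * f v"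
      by blast
    define u where "u = vec n (\<lambda>i. f (vs ! i))"
    have u: "u \<in> carrier_vec n" by (simp add: u_def)
    obtain i where "i < n" "f (vs ! i) \<noteq> 0" using f(1) unfolding vs(2)[symmetric] in_set_conv_nth len Bex_def by auto
    then have "u $ i \<noteq> 0\<^sub>v n $ i" by (simp add: u_def)
    then have "u \<noteq> 0\<^sub>v n" by metis
    moreover have "A *\<^sub>v u = \<theta> \<cdot>\<^sub>v u"
    proof (rule eq_vecI)
      fix i assume "i < dim_vec (\<theta> \<cdot>\<^sub>v u)"
      then have i: "i < n" by (simp add: u_def)
      have "(A *\<^sub>v u) $ i = adj_sum f (vs ! i)" by (rule row[OF i u]) (simp add: u_def)
      also have "\<dots> = \<theta> * f (vs ! i)" by (rule f(2)) (metis i len nth_mem vs(2))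
      finally show "(A *\<^sub>v u) $ i = (\<theta> \<cdot>\<^sub>v u) $ i" using i by (simp add: u_def)
    qed (simp add: A_def u_def)
    ultimately show "eigenvalue (adjacency_matrix G) \<theta>"
      unfolding A eigenvalue_def eigenvector_def using u by (auto simp: A_def)
  qed
qed

lemma spectral_radius_perron_rayleigh:
  assumes G: "pair_graph G" and "pverts G \<noteq> {}"
  obtains x where "\<And>v. 0 \<le> x v" "\<exists>v\<in>pverts G. x v \<noteq> 0"
    and "\<And>v. v \<in> pverts G \<Longrightarrow>
      simple_graph.adj_sum (parcs G) x v = graph_spectral_radius G * x v"
    and "\<And>f. simple_graph.adj_form (parcs G) f f \<le> graph_spectral_radius G * (\<Sum>v\<in>pverts G. (f v)\<^sup>2)"
proof -
  interpret simple_graph "pverts G" "parcs G" by (rule simple_graphI[OF G])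
  obtain \<mu> x where x: "\<And>v. 0 \<le> x v" "\<exists>v\<in>pverts G. x v \<noteq> 0"
    and eig: "\<And>v. v \<in> pverts G \<Longrightarrow> adj_sum x v = \<mu> * x v"
    and ray: "\<And>f. adj_form f f \<le> \<mu> * (\<Sum>v\<in>pverts G. (f v)\<^sup>2)"
    using perron_rayleigh[OF assms(2)] by metis
  have rho: "graph_spectral_radius G = \<mu>"
    unfolding graph_spectral_radius_def
  proof (rule Max_eqI)
    show "finite (spectrum (adjacency_matrix G))"
      by (rule card_finite_spectrum(1)[of _ "card (pverts G)"])
        (simp add: adjacency_matrix_def Let_def)
    show "\<mu> \<in> spectrum (adjacency_matrix G)"
      using x(2) eig unfolding spectrum_def eigenvalue_adjacency_matrix_iff[OF G, abs_def] by blast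
  next
    fix \<theta> assume "\<theta> \<in> spectrum (adjacency_matrix G)"
    then obtain f where f: "\<exists>v\<in>pverts G. f v \<noteq> 0" "\<And>v. v \<in> pverts G \<Longrightarrow> adj_sum f v = \<theta> * f v"
      unfolding spectrum_def eigenvalue_adjacency_matrix_iff[OF G, abs_def] by blast
    have "adj_form f f = (\<Sum>v\<in>pverts G. \<theta> * (f v)\<^sup>2)"
      unfolding adj_form_eq by (rule sum.cong) (auto simp: f(2) power2_eq_square)
    also have "\<dots> = \<theta> * (\<Sum>v\<in>pverts G. (f v)\<^sup>2)" by (simp add: sum_distrib_left)
    finally have "\<theta> * (\<Sum>v\<in>pverts G. (f v)\<^sup>2) \<le> \<mu> * (\<Sum>v\<in>pverts G. (f v)\<^sup>2)"
      using ray[of f] by simp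
    moreover have "(\<Sum>v\<in>pverts G. (f v)\<^sup>2) > 0"
    proof -
      obtain v where "v \<in> pverts G" "f v \<noteq> 0" using f(1) by blast
      then show ?thesis by (intro sum_pos2[OF finite_V, of v]) simp_all
    qed
    ultimately show "\<theta> \<le> \<mu>" by (rule mult_right_le_imp_le)
  qed
  have "adj_sum x v = graph_spectral_radius G * x v" if "v \<in> pverts G" for v
    unfolding rho using that by (rule eig)
  moreover have "adj_form f f \<le> graph_spectral_radius G * (\<Sum>v\<in>pverts G. (f v)\<^sup>2)" for f
    unfolding rho by (rule ray)
  ultimately show thesis by (rule that[OF x])
qed

section \<open>Spanning paths and saturated graphs\<close>

definition spanning_path :: "'a set \<Rightarrow> ('a \<times> 'a) set \<Rightarrow> 'a \<Rightarrow> 'a list \<Rightarrow> 'a \<Rightarrow> bool" where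
  "spanning_path V E x p y \<longleftrightarrow> p \<noteq> [] \<and> distinct p \<and> set p = V
     \<and> successively (\<lambda>a b. (a, b) \<in> E) p \<and> hd p = x \<and> last p = y"

lemma hamilton_path_iff: "hamilton_path G x p y \<longleftrightarrow> spanning_path (pverts G) (parcs G) x p y"
proof -
  have "set (vwalk_arcs p) \<subseteq> parcs G \<longleftrightarrow> successively (\<lambda>a b. (a, b) \<in> parcs G) p"
    by (induction p rule: vwalk_arcs.induct) auto
  then show ?thesis
    unfolding hamilton_path_def spanning_path_def vpath_def vwalk_def by auto
qed

text \<open>
  The segment from position \<open>k + 1\<close> to position \<open>l\<close> is reversed. This removes the steps out of the
  positions \<open>k\<close> and \<open>l\<close> and uses the two given arcs in their place, so a step of the old path that is not
  an arc can be repaired.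
\<close>

lemma spanning_path_flip:
  assumes p: "distinct p" "set p = V"
    and kl: "k < l" "Suc l < length p"
    and new: "(p ! k, p ! l) \<in> E" "(p ! Suc k, p ! Suc l) \<in> E" and "sym E"
    and old: "\<And>m. Suc m < length p \<Longrightarrow> m \<noteq> k \<Longrightarrow> m \<noteq> l \<Longrightarrow> (p ! m, p ! Suc m) \<in> E"
  shows "\<exists>q. spanning_path V E (hd p) q (last p)"
proof -
  define A where "A = take (Suc k) p"
  define B where "B = drop (Suc k) (take (Suc l) p)"
  define C where "C = drop (Suc l) p"
  have "take (Suc l) p = A @ B"
    using kl unfolding A_def B_def by (metis Suc_lessD Suc_less_eq append_take_drop_id min.absorb1 nat_less_le take_take)
  then have pABC: "p = A @ B @ C"
    unfolding C_def by (metis append.assoc append_take_drop_id)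
  have len: "length A = Suc k" "length B = l - k" "length C = length p - Suc l"
    using kl by (auto simp: A_def B_def C_def)
  then have ne: "A \<noteq> []" "B \<noteq> []" "C \<noteq> []" using kl by auto
  have nthA: "A ! i = p ! i" if "i < Suc k" for i using that by (simp add: A_def)
  have nthB: "B ! i = p ! (Suc k + i)" if "i < l - k" for i using that kl by (simp add: B_def)
  have nthC: "C ! i = p ! (Suc l + i)" if "i < length p - Suc l" for i using that kl by (simp add: C_def)
  let ?P = "\<lambda>a b. (a, b) \<in> E"
  have sA: "successively ?P A"
    unfolding successively_conv_nth len using kl by (auto simp: nthA intro!: old)
  have sB: "successively ?P B"
    unfolding successively_conv_nth len
  proof (intro allI impI)
    fix i assume i: "Suc i < l - k"
    have "(p ! (Suc k + i), p ! Suc (Suc k + i)) \<in> E" using i kl by (intro old) auto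
    then show "(B ! i, B ! Suc i) \<in> E" using i by (simp add: nthB)
  qed
  have sC: "successively ?P C"
    unfolding successively_conv_nth len
  proof (intro allI impI)
    fix i assume i: "Suc i < length p - Suc l"
    have "(p ! (Suc l + i), p ! Suc (Suc l + i)) \<in> E" using i kl by (intro old) auto
    then show "(C ! i, C ! Suc i) \<in> E" using i by (simp add: nthC)
  qed
  have "successively ?P (rev B)"
    using sB unfolding successively_rev by (rule successively_mono) (rule symD[OF \<open>sym E\<close>])
  moreover have "last A = p ! k" using ne len nthA by (simp add: last_conv_nth)
  moreover have "hd B = p ! Suc k" using ne len nthB kl by (simp add: hd_conv_nth)
  moreover have "last B = p ! l" using ne len nthB kl by (simp add: last_conv_nth)
  moreover have "hd C = p ! Suc l" using ne len nthC kl by (simp add: hd_conv_nth)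
  ultimately have "successively ?P (A @ rev B @ C)"
    using sA sC ne new by (auto simp: successively_append_iff hd_rev last_rev)
  moreover have "distinct (A @ rev B @ C)" "set (A @ rev B @ C) = V"
    using p unfolding pABC by auto
  moreover have "hd (A @ rev B @ C) = hd p" "last (A @ rev B @ C) = last p"
    using ne unfolding pABC by auto
  ultimately show ?thesis unfolding spanning_path_def using ne by blast
qed

context simple_graph
begin

text \<open>
  Ore's crossing argument, for Hamilton paths with prescribed ends. The path in the enlarged graph runs
  through the new edge \<open>ab\<close> at positions \<open>i\<close>, \<open>i + 1\<close>. If \<open>a\<close> were adjacent to the vertex at some
  position \<open>j\<close> and \<open>b\<close> to the one at \<open>j + 1\<close>, flipping the segment between the two steps would avoid the
  new edge. So the two neighbourhoods occupy disjoint sets of steps, among the \<open>n - 2\<close> steps other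
  than \<open>i\<close>.
\<close>

lemma degree_sum_le_if_edge_creates_path:
  assumes uv: "(u, v) \<notin> E"
    and noE: "\<And>p. \<not> spanning_path V E x p y"
    and p: "spanning_path V (E \<union> {(u, v), (v, u)}) x p y"
  shows "deg u + deg v \<le> card V"
proof -
  define n where "n = length p"
  have pd: "distinct p" "set p = V" "hd p = x" "last p = y" "p \<noteq> []"
    using p by (auto simp: spanning_path_def)
  have n: "card V = n" using pd distinct_card n_def by metis
  have steps: "(p ! m, p ! Suc m) \<in> E \<union> {(u, v), (v, u)}" if "Suc m < n" for m
    using p that unfolding spanning_path_def successively_conv_nth n_def by blast
  have "\<not> successively (\<lambda>a b. (a, b) \<in> E) p"
    using noE[of p] pd by (auto simp: spanning_path_def)
  then obtain i where i: "Suc i < n" "(p ! i, p ! Suc i) \<notin> E"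
    unfolding successively_conv_nth n_def by blast
  define a where "a = p ! i"
  define b where "b = p ! Suc i"
  have ab: "a = u \<and> b = v \<or> a = v \<and> b = u"
    using steps[OF i(1)] i(2) by (auto simp: a_def b_def)
  have inj: "p ! j = p ! k \<longleftrightarrow> j = k" if "j < n" "k < n" for j k
    using that pd(1) by (simp add: n_def nth_eq_iff_index_eq)
  have old: "(p ! m, p ! Suc m) \<in> E" if "Suc m < n" "m \<noteq> i" for m
  proof (rule ccontr)
    assume "(p ! m, p ! Suc m) \<notin> E"
    with steps[OF that(1)] ab have "p ! m = a \<or> p ! m = b \<and> p ! Suc m = a" by auto
    then show False
      using that i inj by (auto simp: a_def b_def)
  qed
  define J1 where "J1 = {j. Suc j < n \<and> (a, p ! j) \<in> E}"
  define J2 where "J2 = {j. Suc j < n \<and> (b, p ! Suc j) \<in> E}"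
  have fin: "finite J1" "finite J2" by (auto simp: J1_def J2_def intro: finite_subset[of _ "{..<n}"])
  have "J1 \<inter> J2 = {}"
  proof (rule ccontr)
    assume "J1 \<inter> J2 \<noteq> {}"
    then obtain j where j: "Suc j < n" "(a, p ! j) \<in> E" "(b, p ! Suc j) \<in> E"
      by (auto simp: J1_def J2_def)
    then have "j \<noteq> i" by (auto simp: a_def)
    then consider "i < j" | "j < i" by linarith
    then have "\<exists>q. spanning_path V E (hd p) q (last p)"
    proof cases
      case 1
      then show ?thesis using pd j i old sym_E
        by (intro spanning_path_flip[of p V i j E]) (auto simp: a_def b_def n_def)
    next
      case 2
      then show ?thesis using pd j i old sym_E
        by (intro spanning_path_flip[of p V j i E]) (auto simp: a_def b_def n_def intro: arc_sym)
    qed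
    then show False using noE pd by auto
  qed
  moreover have "J1 \<union> J2 \<subseteq> {..<n - 1} - {i}" by (auto simp: J1_def J2_def a_def b_def)
  ultimately have "card J1 + card J2 \<le> card ({..<n - 1} - {i})"
    using fin by (metis card_Un_disjoint card_mono finite_Diff finite_lessThan)
  also have "\<dots> = n - 2" using i(1) by (simp add: card_Diff_singleton_if numeral_2_eq_2)
  finally have cJ: "card J1 + card J2 \<le> n - 2" .
  have idx: "\<exists>j<n. w = p ! j" if "(c, w) \<in> E" for c w
    using that E_subset pd(2) by (metis in_set_conv_nth mem_Sigma_iff n_def subsetD)
  \<comment> \<open>The last vertex starts no step and the first one ends none, so each degree may exceed the number of
    steps by one.\<close>
  have "E `` {a} \<subseteq> insert (p ! (n - 1)) ((!) p ` J1)"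
  proof
    fix w assume "w \<in> E `` {a}"
    then obtain j where j: "j < n" "w = p ! j" "(a, p ! j) \<in> E" using idx by blast
    then show "w \<in> insert (p ! (n - 1)) ((!) p ` J1)"
      by (cases "j = n - 1") (auto simp: J1_def)
  qed
  then have "deg a \<le> card (insert (p ! (n - 1)) ((!) p ` J1))"
    unfolding deg_def using fin by (intro card_mono) auto
  also have "\<dots> \<le> Suc (card ((!) p ` J1))" by (rule card_insert_le_m1) auto
  also have "\<dots> \<le> Suc (card J1)" using fin by (simp add: card_image_le)
  finally have da: "deg a \<le> Suc (card J1)" .
  have "E `` {b} \<subseteq> insert (p ! 0) ((\<lambda>j. p ! Suc j) ` J2)"
  proof
    fix w assume "w \<in> E `` {b}"
    then obtain j where j: "j < n" "w = p ! j" "(b, p ! j) \<in> E" using idx by blast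
    then show "w \<in> insert (p ! 0) ((\<lambda>j. p ! Suc j) ` J2)"
      by (cases j) (auto simp: J2_def)
  qed
  then have "deg b \<le> card (insert (p ! 0) ((\<lambda>j. p ! Suc j) ` J2))"
    unfolding deg_def using fin by (intro card_mono) auto
  also have "\<dots> \<le> Suc (card ((\<lambda>j. p ! Suc j) ` J2))" by (rule card_insert_le_m1) auto
  also have "\<dots> \<le> Suc (card J2)" using fin by (simp add: card_image_le)
  finally have db: "deg b \<le> Suc (card J2)" .
  have "deg a + deg b \<le> n" using da db cJ i(1) by linarith
  then show ?thesis using ab n by auto
qed

lemma spanning_path_complete:
  assumes complete: "\<And>a b. a \<in> V \<Longrightarrow> b \<in> V \<Longrightarrow> a \<noteq> b \<Longrightarrow> (a, b) \<in> E"
    and xy: "x \<in> V" "y \<in> V" "x \<noteq> y"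
  shows "\<exists>p. spanning_path V E x p y"
proof -
  obtain zs where zs: "set zs = V - {x, y}" "distinct zs"
    using finite_distinct_list[of "V - {x, y}"] finite_V by auto
  define p where "p = x # zs @ [y]"
  have p: "distinct p" "set p = V" using zs xy by (auto simp: p_def)
  have "(p ! i, p ! Suc i) \<in> E" if "Suc i < length p" for i
    using that p by (intro complete) (auto simp: nth_eq_iff_index_eq)
  then have "spanning_path V E x p y"
    using p by (auto simp: spanning_path_def successively_conv_nth p_def)
  then show ?thesis by blast
qed

text \<open>
  A maximal graph without a Hamilton path between the two given vertices: any further edge creates such
  a path, so the previous bound applies to each non-adjacent pair. Only one pair of ends is kept without
  a path, which makes the added edge easy to trace.
\<close>

lemma saturated_supergraph:
  assumes noE: "\<And>p. \<not> spanning_path V E x p y"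
  obtains H where "simple_graph V H" "E \<subseteq> H" "\<And>p. \<not> spanning_path V H x p y"
    and "\<And>u v. u \<in> V \<Longrightarrow> v \<in> V \<Longrightarrow> u \<noteq> v \<Longrightarrow> (u, v) \<notin> H
      \<Longrightarrow> simple_graph.deg H u + simple_graph.deg H v \<le> card V"
proof -
  define \<H> where "\<H> = {H. simple_graph V H \<and> (\<forall>p. \<not> spanning_path V H x p y)}"
  have "\<H> \<subseteq> Pow (V \<times> V)" by (auto simp: \<H>_def simple_graph_def)
  then have "finite \<H>" using finite_V by (meson finite_Pow_iff finite_SigmaI finite_subset)
  moreover have "E \<in> \<H>" using noE simple_graph_axioms by (auto simp: \<H>_def)
  ultimately obtain H where H: "H \<in> \<H>" "E \<subseteq> H" and max: "\<And>F. F \<in> \<H> \<Longrightarrow> H \<subseteq> F \<Longrightarrow> F = H"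
    using finite_has_maximal2[of \<H> E] by metis
  interpret H: simple_graph V H using H(1) by (simp add: \<H>_def)
  have noH: "\<not> spanning_path V H x p y" for p using H(1) by (simp add: \<H>_def)
  have "H.deg u + H.deg v \<le> card V" if "u \<in> V" "v \<in> V" "u \<noteq> v" "(u, v) \<notin> H" for u v
  proof -
    have "simple_graph V (H \<union> {(u, v), (v, u)})"
      using that H.finite_V H.E_subset H.irrefl_E H.sym_E
      unfolding simple_graph_def irrefl_def sym_def by auto
    moreover have "H \<union> {(u, v), (v, u)} \<noteq> H" using that by auto
    ultimately obtain p where "spanning_path V (H \<union> {(u, v), (v, u)}) x p y"
      using max[of "H \<union> {(u, v), (v, u)}"] unfolding \<H>_def by blast
    then show ?thesis using H.degree_sum_le_if_edge_creates_path noH that(4) by blast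
  qed
  then show thesis using that[OF H.simple_graph_axioms H(2) noH] by blast
qed

end

section \<open>Degrees in a saturated graph with many edges\<close>

context simple_graph
begin

lemma deg_le_card: "v \<in> V \<Longrightarrow> deg v \<le> card V - 1"
proof -
  assume v: "v \<in> V"
  have "E `` {v} \<subseteq> V - {v}" using nbhd_subset by auto
  then have "deg v \<le> card (V - {v})" unfolding deg_def using finite_V by (intro card_mono) auto
  then show ?thesis using v by simp
qed

text \<open>
  Chvatal's argument. Take a non-adjacent pair \<open>u\<close>, \<open>v\<close> with largest degree sum and \<open>deg u \<le> deg v\<close>. Since
  exchanging one of the two for another vertex cannot increase the sum, non-neighbours of \<open>v\<close> have
  degree at most \<open>deg u\<close>, and non-neighbours of \<open>u\<close> have degree at most \<open>deg v \<le> n - deg u\<close>.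
\<close>

lemma low_degree_sets:
  assumes ore: "\<And>u v. u \<in> V \<Longrightarrow> v \<in> V \<Longrightarrow> u \<noteq> v \<Longrightarrow> (u, v) \<notin> E \<Longrightarrow> deg u + deg v \<le> card V"
    and incomplete: "\<exists>u\<in>V. \<exists>v\<in>V. u \<noteq> v \<and> (u, v) \<notin> E"
  obtains k u W U where "u \<in> V" "deg u = k" "2 * k \<le> card V"
    and "W \<subseteq> V" "card W = k - 1" "\<And>w. w \<in> W \<Longrightarrow> deg w \<le> k"
    and "U \<subseteq> V" "card U = card V - k" "\<And>w. w \<in> U \<Longrightarrow> deg w \<le> card V - k"
proof -
  define N where "N = {(u, v). u \<in> V \<and> v \<in> V \<and> u \<noteq> v \<and> (u, v) \<notin> E}"
  have "N \<subseteq> V \<times> V" by (auto simp: N_def)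
  then have fN: "finite N" using finite_V by (meson finite_SigmaI finite_subset)
  have "N \<noteq> {}" using incomplete by (auto simp: N_def)
  define s where "s e = deg (fst e) + deg (snd e)" for e
  have "Max (s ` N) \<in> s ` N" using fN \<open>N \<noteq> {}\<close> by (intro Max_in) auto
  then obtain e where e: "e \<in> N" "s e = Max (s ` N)" by auto
  have emax: "deg (fst e') + deg (snd e') \<le> deg (fst e) + deg (snd e)" if "e' \<in> N" for e'
    using Max_ge[of "s ` N" "s e'"] fN that e(2) by (simp add: s_def)
  define u where "u = (if deg (fst e) \<le> deg (snd e) then fst e else snd e)"
  define v where "v = (if deg (fst e) \<le> deg (snd e) then snd e else fst e)"
  have uv: "(u, v) \<in> N" using e arc_sym by (auto simp: N_def u_def v_def)
  have duv: "deg u \<le> deg v" by (auto simp: u_def v_def)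
  have max: "deg a + deg b \<le> deg u + deg v" if "(a, b) \<in> N" for a b
    using emax[OF that] by (auto simp: u_def v_def)
  define k where "k = deg u"
  define n where "n = card V"
  have sum_le: "deg u + deg v \<le> n" using uv ore unfolding N_def n_def by auto
  have nonnbr: "card (V - E `` {z}) = n - deg z" for z
    unfolding n_def deg_def by (rule card_Diff_subset[OF finite_nbhd nbhd_subset])
  have "v \<in> V - E `` {v}" using uv by (auto simp: N_def)
  then have "card (V - E `` {v} - {v}) = n - deg v - 1"
    using nonnbr[of v] finite_V by simp
  then have "k - 1 \<le> card (V - E `` {v} - {v})"
    using sum_le unfolding k_def by linarith
  then obtain W where W: "W \<subseteq> V - E `` {v} - {v}" "card W = k - 1"
    using obtain_subset_with_card_n by metis
  have "deg w \<le> k" if "w \<in> W" for w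
  proof -
    have "(w, v) \<in> N" using that W uv arc_sym by (auto simp: N_def)
    then show ?thesis using max[of w v] by (simp add: k_def)
  qed
  moreover have "deg w \<le> n - k" if w: "w \<in> V - E `` {u}" for w
  proof (cases "w = u")
    case True
    then show ?thesis using duv sum_le by (simp add: k_def)
  next
    case False
    then have "(u, w) \<in> N" using w uv by (auto simp: N_def)
    then show ?thesis using max[of u w] sum_le by (simp add: k_def)
  qed
  moreover have "u \<in> V" using uv by (simp add: N_def)
  ultimately show thesis
    using that[of u k W "V - E `` {u}"] W nonnbr[of u] duv sum_le
    unfolding k_def n_def by auto
qed

text \<open>
  The sets just found bound the degree sum by \<open>3k\<^sup>2 - 3k - 2nk + n\<^sup>2 + n\<close>, a convex function of \<open>k\<close>. At
  \<open>k = 3\<close> this exceeds the assumed lower bound by \<open>4\<close>; for \<open>4 \<le> k \<le> n/2\<close> it falls short of it, except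
  that \<open>k = 7\<close>, \<open>n = 14\<close> gives equality. The degrees \<open>d\<close> are those of a subgraph, so that the equality
  case also determines the degrees of the subgraph.
\<close>

lemma dense_nonadjacent_low_degrees:
  assumes d: "\<And>v. v \<in> V \<Longrightarrow> d v \<le> deg v" "\<And>v. v \<in> V \<Longrightarrow> 3 \<le> d v"
    and dense: "(card V)\<^sup>2 + 14 \<le> (\<Sum>v\<in>V. d v) + 5 * card V" and n14: "14 \<le> card V"
    and ore: "\<And>u v. u \<in> V \<Longrightarrow> v \<in> V \<Longrightarrow> u \<noteq> v \<Longrightarrow> (u, v) \<notin> E \<Longrightarrow> deg u + deg v \<le> card V"
    and incomplete: "\<exists>u\<in>V. \<exists>v\<in>V. u \<noteq> v \<and> (u, v) \<notin> E"
  shows "(\<exists>u\<in>V. \<exists>w\<in>V. u \<noteq> w \<and> deg u \<le> 3 \<and> deg w \<le> 3)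
    \<or> (card V = 14 \<and> (\<Sum>v\<in>V. d v) = 140 \<and> (\<forall>v\<in>V. 7 \<le> d v))"
proof -
  obtain k u W U where u: "u \<in> V" "deg u = k" and k: "2 * k \<le> card V"
    and W: "W \<subseteq> V" "card W = k - 1" "\<And>w. w \<in> W \<Longrightarrow> deg w \<le> k"
    and U: "U \<subseteq> V" "card U = card V - k" "\<And>w. w \<in> U \<Longrightarrow> deg w \<le> card V - k"
    by (rule low_degree_sets[OF ore incomplete]) blast+
  define n where "n = card V"
  have k3: "3 \<le> k" using d[OF u(1)] u(2) by simp
  \<comment> \<open>The two low-degree sets may overlap in any way; the smaller bound is used on the overlap, and the
    worst case for the sum below is \<open>W \<subseteq> U\<close>.\<close>
  define b where "b v = (if v \<in> W then k else if v \<in> U then n - k else n - 1)" for v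
  have db: "d v \<le> b v" if "v \<in> V" for v
    using d(1)[OF that] W(3)[of v] U(3)[of v] deg_le_card[OF that]
    by (auto simp: b_def n_def)
  have fin: "finite W" "finite U" using W U finite_V finite_subset by auto
  define t where "t = card (U - W)"
  have t: "n - k - (k - 1) \<le> t"
    unfolding t_def using diff_card_le_card_Diff[OF fin(1), of U] W(2) U(2) n_def by simp
  have cardR: "card (V - W - U) + (k - 1) + t = n"
  proof -
    have "n = card ((V - W - U) \<union> (W \<union> (U - W)))"
      unfolding n_def using W(1) U(1) by (intro arg_cong[of _ _ card]) auto
    also have "\<dots> = card (V - W - U) + card (W \<union> (U - W))"
      using fin finite_V by (intro card_Un_disjoint) auto
    also have "card (W \<union> (U - W)) = card W + t"
      unfolding t_def using fin by (intro card_Un_disjoint) auto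
    finally show ?thesis using W(2) by simp
  qed
  have "(\<Sum>v\<in>V. b v) = (\<Sum>v\<in>W. b v) + (\<Sum>v\<in>V - W. b v)"
    using W(1) finite_V by (simp add: sum.subset_diff add.commute)
  also have "(\<Sum>v\<in>V - W. b v) = (\<Sum>v\<in>U - W. b v) + (\<Sum>v\<in>V - W - U. b v)"
  proof -
    have "(\<Sum>v\<in>V - W. b v) = (\<Sum>v\<in>(V - W) - (U - W). b v) + (\<Sum>v\<in>U - W. b v)"
      using U(1) finite_V by (intro sum.subset_diff) auto
    moreover have "(V - W) - (U - W) = V - W - U" by auto
    ultimately show ?thesis by simp
  qed
  also have "(\<Sum>v\<in>W. b v) = (\<Sum>v\<in>W. k)" by (rule sum.cong) (auto simp: b_def)
  also have "(\<Sum>v\<in>U - W. b v) = (\<Sum>v\<in>U - W. n - k)" by (rule sum.cong) (auto simp: b_def)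
  also have "(\<Sum>v\<in>V - W - U. b v) = (\<Sum>v\<in>V - W - U. n - 1)" by (rule sum.cong) (auto simp: b_def)
  finally have sumb: "(\<Sum>v\<in>V. b v) = (k - 1) * k + (t * (n - k) + card (V - W - U) * (n - 1))"
    using W(2) by (simp add: t_def)
  define N K T where "N = int n" and "K = int k" and "T = int t"
  have kn: "k \<le> n" "1 \<le> n" using k n14 by (auto simp: n_def)
  have cR: "int (card (V - W - U)) = N - (K - 1) - T"
    using cardR k3 unfolding N_def K_def T_def by linarith
  have "int (\<Sum>v\<in>V. b v) = (K - 1) * K + (T * (N - K) + (N - (K - 1) - T) * (N - 1))"
    unfolding sumb using kn k3 cR by (simp add: N_def K_def T_def of_nat_diff)
  also have "\<dots> = (K - 1) * K + (N - K + 1) * (N - 1) - T * (K - 1)"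
    by (simp add: algebra_simps)
  also have "\<dots> \<le> (K - 1) * K + (N - K + 1) * (N - 1) - (N - 2 * K + 1) * (K - 1)"
  proof -
    have "N - 2 * K + 1 \<le> T" using t k k3 unfolding N_def K_def T_def n_def by linarith
    then show ?thesis using k3 by (simp add: K_def mult_right_mono)
  qed
  also have "\<dots> = 3 * K\<^sup>2 - 3 * K - 2 * N * K + N\<^sup>2 + N"
    by (simp add: algebra_simps power2_eq_square)
  finally have b_le: "int (\<Sum>v\<in>V. b v) \<le> 3 * K\<^sup>2 - 3 * K - 2 * N * K + N\<^sup>2 + N" .
  have d_ge: "N\<^sup>2 + 14 - 5 * N \<le> int (\<Sum>v\<in>V. d v)"
  proof -
    have "int (n\<^sup>2 + 14) \<le> int ((\<Sum>v\<in>V. d v) + 5 * n)"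
      using dense unfolding n_def by (simp only: of_nat_le_iff)
    then show ?thesis by (simp add: N_def)
  qed
  have d_le_b: "(\<Sum>v\<in>V. d v) \<le> (\<Sum>v\<in>V. b v)" by (rule sum_mono) (rule db)
  then have d_le_b': "int (\<Sum>v\<in>V. d v) \<le> int (\<Sum>v\<in>V. b v)" by (simp only: of_nat_le_iff)
  have "N\<^sup>2 + 14 - 5 * N \<le> 3 * K\<^sup>2 - 3 * K - 2 * N * K + N\<^sup>2 + N"
    using b_le d_ge d_le_b' by linarith
  then have le0: "0 \<le> (6 - 2 * K) * N + 3 * K\<^sup>2 - 3 * K - 14"
    by (simp add: algebra_simps)
  have N: "14 \<le> N" "2 * K \<le> N" "3 \<le> K" using n14 k k3 by (auto simp: N_def K_def n_def)
  have "K = 3 \<or> K = 7 \<and> N = 14"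
  proof (rule ccontr)
    assume neg: "\<not> ?thesis"
    then have K4: "4 \<le> K" using N by auto
    consider "K \<le> 6" | "7 \<le> K" by linarith
    then show False
    proof cases
      case 1
      then have "K = 4 \<or> K = 5 \<or> K = 6" using K4 by auto
      then show False using le0 N(1) by auto
    next
      case 2
      \<comment> \<open>The coefficient of \<open>N\<close> is negative, so the worst case is \<open>N = 2 * K\<close>, where the expression
        becomes \<open>- (K - 2) * (K - 7)\<close>.\<close>
      have "(6 - 2 * K) * N \<le> (6 - 2 * K) * (2 * K)"
        using N K4 by (intro mult_left_mono_neg) auto
      with le0 have "0 \<le> - ((K - 2) * (K - 7))"
        by (simp add: algebra_simps power2_eq_square)
      moreover have "0 \<le> (K - 2) * (K - 7)" using 2 by simp
      ultimately have "(K - 2) * (K - 7) = 0" by simp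
      then have "K = 7" using 2 by auto
      then show False using le0 N neg by simp
    qed
  qed
  then show ?thesis
  proof
    assume "K = 3"
    then have "card W = 2" "k = 3" using W(2) by (auto simp: K_def)
    then obtain w1 w2 where "W = {w1, w2}" "w1 \<noteq> w2" by (meson card_2_iff)
    then show ?thesis using W(1,3) \<open>k = 3\<close> by auto
  next
    assume KN: "K = 7 \<and> N = 14"
    then have kn: "k = 7" "n = 14" by (auto simp: K_def N_def)
    have "3 * K\<^sup>2 - 3 * K - 2 * N * K + N\<^sup>2 + N = 140" "N\<^sup>2 + 14 - 5 * N = 140"
      using KN by simp_all
    then have "int (\<Sum>v\<in>V. d v) = 140" "int (\<Sum>v\<in>V. b v) = 140"
      using b_le d_ge d_le_b' by linarith+
    then have sums: "(\<Sum>v\<in>V. d v) = 140" "(\<Sum>v\<in>V. b v) = 140"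
      by linarith+
    have "d v = b v" if "v \<in> V" for v
    proof (rule ccontr)
      assume "d v \<noteq> b v"
      then have "d v < b v" using db[OF that] by simp
      then have "(\<Sum>v\<in>V. d v) < (\<Sum>v\<in>V. b v)"
        using that finite_V db by (intro sum_strict_mono_ex1) auto
      then show False using sums by simp
    qed
    then have "\<forall>v\<in>V. 7 \<le> d v" using kn by (auto simp: b_def)
    then show ?thesis using sums kn by (simp add: n_def)
  qed
qed

text \<open>
  A non-adjacent pair \<open>z\<close>, \<open>z'\<close> contributes at most \<open>n\<close> to the degree sum, about half of what two vertices
  of a clique of size \<open>n - 2\<close> would. Every vertex other than these four has at most \<open>n - 3\<close> neighbours
  besides \<open>u\<close> and \<open>w\<close>, and at most six arcs lead to \<open>u\<close> or \<open>w\<close>; altogether this is too little.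
\<close>

lemma clique_off_two_low_vertices:
  assumes dense: "(card V)\<^sup>2 + 14 \<le> (\<Sum>v\<in>V. deg v) + 5 * card V" and n: "11 \<le> card V"
    and ore: "\<And>u v. u \<in> V \<Longrightarrow> v \<in> V \<Longrightarrow> u \<noteq> v \<Longrightarrow> (u, v) \<notin> E \<Longrightarrow> deg u + deg v \<le> card V"
    and uw: "u \<in> V" "w \<in> V" "u \<noteq> w" "deg u \<le> 3" "deg w \<le> 3"
    and z: "z \<in> V - {u, w}" "z' \<in> V - {u, w}" "z \<noteq> z'"
  shows "(z, z') \<in> E"
proof (rule ccontr)
  assume "(z, z') \<notin> E"
  then have zz: "deg z + deg z' \<le> card V" using ore z by auto
  define R where "R = V - {u, w, z, z'}"
  have finR: "finite R" using finite_V by (simp add: R_def)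
  have four: "card {u, w, z, z'} = 4" "{u, w, z, z'} \<subseteq> V" using uw z by auto
  have cR: "card R = card V - 4"
    unfolding R_def using four by (simp add: card_Diff_subset)
  have nbr: "(\<Sum>y\<in>R. of_bool ((y, c) \<in> E)) \<le> (3::nat)" if "deg c \<le> 3" for c
  proof -
    have "(\<Sum>y\<in>R. of_bool ((y, c) \<in> E)) = card {y \<in> R. (y, c) \<in> E}"
      using finR by (simp add: of_bool_def sum.If_cases Int_def)
    also have "\<dots> \<le> deg c"
      unfolding deg_def using finite_nbhd by (intro card_mono) (auto intro: arc_sym)
    finally show ?thesis using that by simp
  qed
  have "deg y \<le> (card V - 3) + (of_bool ((y, u) \<in> E) + of_bool ((y, w) \<in> E))" if y: "y \<in> R" for y
  proof -
    have "E `` {y} \<subseteq> (V - {u, w, y}) \<union> ({c. c = u \<and> (y, u) \<in> E} \<union> {c. c = w \<and> (y, w) \<in> E})"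
      using nbhd_subset by auto
    then have "deg y \<le> card ((V - {u, w, y}) \<union> ({c. c = u \<and> (y, u) \<in> E} \<union> {c. c = w \<and> (y, w) \<in> E}))"
      unfolding deg_def using finite_V by (intro card_mono) auto
    also have "\<dots> \<le> card (V - {u, w, y}) + (card {c. c = u \<and> (y, u) \<in> E} + card {c. c = w \<and> (y, w) \<in> E})"
      by (meson add_left_mono card_Un_le le_trans)
    also have "card {c. c = u \<and> (y, u) \<in> E} = of_bool ((y, u) \<in> E)" by (cases "(y, u) \<in> E") auto
    also have "card {c. c = w \<and> (y, w) \<in> E} = of_bool ((y, w) \<in> E)" by (cases "(y, w) \<in> E") auto
    also have "card (V - {u, w, y}) = card V - card {u, w, y}"
      using y uw by (intro card_Diff_subset) (auto simp: R_def)
    also have "card {u, w, y} = 3" using y uw by (auto simp: R_def)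
    finally show ?thesis .
  qed
  then have "(\<Sum>y\<in>R. deg y) \<le> (\<Sum>y\<in>R. (card V - 3) + (of_bool ((y, u) \<in> E) + of_bool ((y, w) \<in> E)))"
    by (rule sum_mono)
  also have "\<dots> = (card V - 4) * (card V - 3)
      + ((\<Sum>y\<in>R. of_bool ((y, u) \<in> E)) + (\<Sum>y\<in>R. of_bool ((y, w) \<in> E)))"
    by (simp only: sum.distrib sum_constant cR of_nat_id)
  also have "\<dots> \<le> (card V - 4) * (card V - 3) + (3 + 3)"
    using nbr uw by (intro add_left_mono add_mono) auto
  finally have sumR: "(\<Sum>y\<in>R. deg y) \<le> (card V - 4) * (card V - 3) + 6" by simp
  have "(\<Sum>v\<in>V. deg v) = (\<Sum>v\<in>R. deg v) + (\<Sum>v\<in>{u, w, z, z'}. deg v)"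
    unfolding R_def using four(2) finite_V by (rule sum.subset_diff)
  also have "(\<Sum>v\<in>{u, w, z, z'}. deg v) = deg u + deg w + (deg z + deg z')" using uw z by auto
  finally have "(\<Sum>v\<in>V. deg v) \<le> (card V - 4) * (card V - 3) + 12 + card V"
    using sumR zz uw by linarith
  with dense have "(card V)\<^sup>2 + 14 \<le> (card V - 4) * (card V - 3) + 12 + 6 * card V" by linarith
  moreover define m where "m = card V - 4"
  then have "card V = m + 4" using n by simp
  ultimately show False using n by (simp add: power2_eq_square algebra_simps)
qed

text \<open>
  A vertex \<open>z\<close> of the clique that is also adjacent to \<open>w\<close> has degree at least \<open>n - 2\<close>; with
  \<open>deg u \<ge> 3\<close> the degree sum of \<open>z\<close> and \<open>u\<close> is too large for a non-adjacent pair.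
\<close>

lemma low_vertices_share_neighbours:
  assumes clique: "\<And>z z'. z \<in> V - {u, w} \<Longrightarrow> z' \<in> V - {u, w} \<Longrightarrow> z \<noteq> z' \<Longrightarrow> (z, z') \<in> E"
    and ore: "\<And>u v. u \<in> V \<Longrightarrow> v \<in> V \<Longrightarrow> u \<noteq> v \<Longrightarrow> (u, v) \<notin> E \<Longrightarrow> deg u + deg v \<le> card V"
    and uw: "u \<in> V" "w \<in> V" "u \<noteq> w" "3 \<le> deg u"
    and z: "z \<noteq> u" "(z, w) \<in> E"
  shows "(z, u) \<in> E"
proof (rule ccontr)
  assume "(z, u) \<notin> E"
  have zV: "z \<in> V - {u, w}" using z E_subset by auto
  have "insert w (V - {u, w, z}) \<subseteq> E `` {z}" using clique[OF zV] z by auto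
  then have "card (insert w (V - {u, w, z})) \<le> deg z"
    unfolding deg_def by (rule card_mono[OF finite_nbhd])
  moreover have "card (V - {u, w, z}) = card V - card {u, w, z}"
    using zV uw by (intro card_Diff_subset) auto
  moreover have "card {u, w, z} \<le> card V" using zV uw finite_V by (intro card_mono) auto
  moreover have "card {u, w, z} = 3" using zV uw by auto
  ultimately have "card V - 2 \<le> deg z" "3 \<le> card V" using finite_V by auto
  moreover have "deg z + deg u \<le> card V" using ore[of z u] zV uw \<open>(z, u) \<notin> E\<close> by auto
  ultimately show False using uw(4) by linarith
qed

end

section \<open>Spectral radius and number of edges\<close>

context simple_graph
begin

lemma sum_deg: "(\<Sum>v\<in>V. deg v) = card E"
proof -
  have "real (\<Sum>v\<in>V. deg v) = real (card E)"
    using sum_arcs[of "\<lambda>_ _. 1"] by (simp add: deg_def)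
  then show ?thesis by (rule of_nat_eq_iff[THEN iffD1])
qed

text \<open>
  Evenness sharpens the lower bound on the degree sum by one, which is what makes \<open>n = 14\<close>, \<open>k = 7\<close> an
  equality case.
\<close>

lemma even_sum_deg: "even (\<Sum>v\<in>V. deg v)"
proof -
  define C where "C = (\<lambda>e. {e, prod.swap e}) ` E"
  have "2 * card C = card (\<Union>C)"
  proof (rule card_partition)
    show "finite C" "finite (\<Union>C)" using finite_E by (auto simp: C_def)
    show "card c = 2" if c: "c \<in> C" for c
    proof -
      obtain a b where "(a, b) \<in> E" "c = {(a, b), (b, a)}" using c by (auto simp: C_def)
      moreover from this have "a \<noteq> b" by auto
      ultimately show ?thesis by simp
    qed
    show "c1 \<inter> c2 = {}" if "c1 \<in> C" "c2 \<in> C" "c1 \<noteq> c2" for c1 c2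
      using that by (auto simp: C_def)
  qed
  moreover have "\<Union>C = E" by (auto simp: C_def intro: arc_sym)
  ultimately show ?thesis unfolding sum_deg by (metis dvd_triv_left)
qed

text \<open>
  The bound of Hong, Shu and Fang. The sum of the degrees of the neighbours of \<open>v\<close> is the total degree
  sum minus \<open>deg v\<close> minus the degrees of the \<open>n - 1 - deg v\<close> non-neighbours, each of which is at least
  \<open>\<delta>\<close>. Weighting this with the entries of a non-negative eigenvector and summing over \<open>v\<close> turns the left
  side into \<open>\<rho>\<^sup>2\<close> and each \<open>deg v\<close> on the right side into \<open>\<rho>\<close>.
\<close>

lemma eigenvalue_edge_bound:
  assumes eig: "\<And>v. v \<in> V \<Longrightarrow> adj_sum x v = \<rho> * x v"
    and x: "\<And>v. 0 \<le> x v" "\<exists>v\<in>V. x v \<noteq> 0"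
    and \<delta>: "\<And>v. v \<in> V \<Longrightarrow> \<delta> \<le> deg v"
  shows "\<rho>\<^sup>2 - (real \<delta> - 1) * \<rho> \<le> real (\<Sum>v\<in>V. deg v) - real \<delta> * (real (card V) - 1)"
proof -
  define S where "S = (\<Sum>v\<in>V. real (deg v))"
  define X where "X = (\<Sum>v\<in>V. x v)"
  define n where "n = real (card V)"
  obtain v0 where "v0 \<in> V" "x v0 \<noteq> 0" using x(2) by blast
  then have X: "X > 0" unfolding X_def
    by (intro sum_pos2[OF finite_V, of v0]) (auto simp: less_le x(1))
  have "(\<Sum>v\<in>V. real (deg v) * x v) = (\<Sum>e\<in>E. x (fst e))"
    by (subst sum_arcs[of "\<lambda>a b. x a"]) (simp add: deg_def)
  also have "\<dots> = (\<Sum>e\<in>E. x (snd e))" by (rule sum_arcs_swap[of "\<lambda>a b. x a"])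
  also have "\<dots> = (\<Sum>v\<in>V. adj_sum x v)"
    unfolding adj_sum_def by (rule sum_arcs[of "\<lambda>a b. x b"])
  also have "\<dots> = \<rho> * X" by (simp add: eig X_def sum_distrib_left)
  finally have degx: "(\<Sum>v\<in>V. real (deg v) * x v) = \<rho> * X" .
  have two: "adj_sum (\<lambda>v. real (deg v)) v \<le> S - real \<delta> * (n - 1) + (real \<delta> - 1) * real (deg v)"
    if v: "v \<in> V" for v
  proof -
    have vN: "v \<in> V - E `` {v}" using v by auto
    have "S = (\<Sum>w\<in>V - E `` {v}. real (deg w)) + adj_sum (\<lambda>v. real (deg v)) v"
      unfolding S_def adj_sum_def using finite_V nbhd_subset by (intro sum.subset_diff) auto
    moreover have "(\<Sum>w\<in>V - E `` {v}. real (deg w))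
        = real (deg v) + (\<Sum>w\<in>V - E `` {v} - {v}. real (deg w))"
      using finite_V by (intro sum.remove[OF _ vN]) auto
    moreover have "(\<Sum>w\<in>V - E `` {v} - {v}. real (deg w)) \<ge> real \<delta> * (n - 1 - real (deg v))"
    proof -
      have "card (V - E `` {v} - {v}) = card V - deg v - 1"
        using finite_V vN card_Diff_subset[OF finite_nbhd nbhd_subset, of v] by (simp add: deg_def)
      moreover have "deg v \<le> card V - 1" "card V \<noteq> 0" using deg_le_card[OF v] v finite_V by auto
      ultimately have c: "real (card (V - E `` {v} - {v})) = n - 1 - real (deg v)"
        by (simp add: n_def)
      have "(\<Sum>w\<in>V - E `` {v} - {v}. real (deg w)) \<ge> (\<Sum>w\<in>V - E `` {v} - {v}. real \<delta>)"
        using \<delta> by (intro sum_mono) auto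
      then show ?thesis unfolding c[symmetric] by (simp add: mult.commute)
    qed
    ultimately show ?thesis by (simp add: algebra_simps)
  qed
  have "\<rho>\<^sup>2 * X = \<rho> * (\<Sum>v\<in>V. real (deg v) * x v)" unfolding degx by (simp add: power2_eq_square)
  also have "\<dots> = adj_form (\<lambda>v. real (deg v)) x"
    unfolding adj_form_eq sum_distrib_left by (rule sum.cong) (auto simp: eig)
  also have "\<dots> = adj_form x (\<lambda>v. real (deg v))" by (rule adj_form_commute)
  also have "\<dots> \<le> (\<Sum>v\<in>V. x v * (S - real \<delta> * (n - 1) + (real \<delta> - 1) * real (deg v)))"
    unfolding adj_form_eq using x(1) two by (intro sum_mono mult_left_mono) auto
  also have "\<dots> = (S - real \<delta> * (n - 1)) * X + (real \<delta> - 1) * (\<Sum>v\<in>V. real (deg v) * x v)"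
    unfolding X_def sum_distrib_left sum.distrib[symmetric]
    by (rule sum.cong) (auto simp: algebra_simps)
  also have "\<dots> = (S - real \<delta> * (n - 1) + (real \<delta> - 1) * \<rho>) * X"
    unfolding degx by (simp add: algebra_simps)
  finally have "\<rho>\<^sup>2 \<le> S - real \<delta> * (n - 1) + (real \<delta> - 1) * \<rho>"
    using X by simp
  then show ?thesis by (simp add: S_def n_def)
qed

end

section \<open>Copies of the extremal graph\<close>

text \<open>
  For disjoint \<open>L\<close>, \<open>T\<close> with two and three elements this is \<open>K\<^sub>3 \<or> (K\<^sub>n\<^sub>-\<^sub>5 + 2K\<^sub>1)\<close> on the vertex set \<open>V\<close>, with
  \<open>T\<close> spanning the \<open>K\<^sub>3\<close> and \<open>L\<close> the \<open>2K\<^sub>1\<close>. In this form it can be compared with other graphs on \<open>V\<close>.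
\<close>

definition extremal_arcs :: "'a set \<Rightarrow> 'a set \<Rightarrow> 'a set \<Rightarrow> ('a \<times> 'a) set" where
  "extremal_arcs V L T =
     {(p, q). p \<in> V \<and> q \<in> V \<and> p \<noteq> q \<and> (p \<in> L \<longrightarrow> q \<in> T) \<and> (q \<in> L \<longrightarrow> p \<in> T)}"

lemma simple_graph_extremal: "finite V \<Longrightarrow> simple_graph V (extremal_arcs V L T)"
  unfolding simple_graph_def extremal_arcs_def irrefl_def sym_def by auto

definition "S3_low = (Inr ` Inr ` ({..<2} \<times> {0}) :: (nat + nat + nat \<times> nat) set)"
definition "S3_hub = (Inl ` {..<3} :: (nat + nat + nat \<times> nat) set)"

lemma pverts_S3: "pverts (S3 n) = {..<3} <+> ({..<n - 5} <+> ({..<2} \<times> {0}))"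
  by (simp add: S3_def join_def disjoint_union_def copies_def complete_graph_def lessThan_Suc)

lemma parcs_S3: "parcs (S3 n) = extremal_arcs (pverts (S3 n)) S3_low S3_hub"
  unfolding pverts_S3
  by (auto simp: S3_def join_def disjoint_union_def copies_def complete_graph_def extremal_arcs_def
      S3_low_def S3_hub_def image_iff elim!: PlusE)

lemma S3_isomorphic_copy:
  assumes "finite V" "card V = n" "5 \<le> n" "L \<subseteq> V" "T \<subseteq> V" "L \<inter> T = {}" "card L = 2" "card T = 3"
  obtains \<phi> where "bij_betw \<phi> V (pverts (S3 n))"
    and "bij_betw (map_prod \<phi> \<phi>) (extremal_arcs V L T) (parcs (S3 n))"
proof -
  define P where "P = pverts (S3 n)"
  have finP: "finite P" by (simp add: P_def pverts_S3)
  have sub: "S3_low \<subseteq> P" "S3_hub \<subseteq> P" "S3_low \<inter> S3_hub = {}"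
    by (auto simp: P_def pverts_S3 S3_low_def S3_hub_def)
  have card: "card S3_low = 2" "card S3_hub = 3" "card P = n"
    using card_pverts_S3[OF assms(3)]
    by (auto simp: S3_low_def S3_hub_def P_def card_image card_cartesian_product)
  have fin: "finite L" "finite T" "finite S3_low" "finite S3_hub"
    using assms finP sub finite_subset by auto
  obtain f where f: "bij_betw f L S3_low"
    using finite_same_card_bij[OF fin(1,3)] assms card by auto
  obtain g where g: "bij_betw g T S3_hub"
    using finite_same_card_bij[OF fin(2,4)] assms card by auto
  have LT: "card (L \<union> T) = 5" "card (S3_low \<union> S3_hub) = 5"
    using assms fin sub card by (auto simp: card_Un_disjoint)
  have "card (V - (L \<union> T)) = card (P - (S3_low \<union> S3_hub))"
    using assms fin sub card LT finP by (subst (1 2) card_Diff_subset) auto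
  then obtain h where h: "bij_betw h (V - (L \<union> T)) (P - (S3_low \<union> S3_hub))"
    using finite_same_card_bij[OF finite_Diff[OF assms(1)] finite_Diff[OF finP]] by metis
  define \<phi> where "\<phi> v = (if v \<in> L then f v else if v \<in> T then g v else h v)" for v
  have "bij_betw \<phi> (L \<union> (T \<union> (V - (L \<union> T)))) (S3_low \<union> (S3_hub \<union> (P - (S3_low \<union> S3_hub))))"
    unfolding \<phi>_def using assms(6) sub(3)
    by (intro bij_betw_disjoint_Un f g h) auto
  moreover have "L \<union> (T \<union> (V - (L \<union> T))) = V" using assms by auto
  moreover have "S3_low \<union> (S3_hub \<union> (P - (S3_low \<union> S3_hub))) = P" using sub by auto
  ultimately have bij: "bij_betw \<phi> V P" by simp
  have low: "\<phi> v \<in> S3_low \<longleftrightarrow> v \<in> L" and hub: "\<phi> v \<in> S3_hub \<longleftrightarrow> v \<in> T" if "v \<in> V" for v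
    using that f g h sub(3) assms(6) bij_betwE[OF f] bij_betwE[OF g] bij_betwE[OF h]
    by (auto simp: \<phi>_def)
  have inj: "\<phi> v = \<phi> w \<longleftrightarrow> v = w" if "v \<in> V" "w \<in> V" for v w
    using that bij by (auto simp: bij_betw_def inj_on_eq_iff)
  have img: "\<phi> ` V = P" using bij by (simp add: bij_betw_def)
  have "bij_betw (map_prod \<phi> \<phi>) (extremal_arcs V L T) (extremal_arcs P S3_low S3_hub)"
    unfolding bij_betw_def
  proof
    show "inj_on (map_prod \<phi> \<phi>) (extremal_arcs V L T)"
      by (auto simp: inj_on_def extremal_arcs_def inj)
    show "map_prod \<phi> \<phi> ` extremal_arcs V L T = extremal_arcs P S3_low S3_hub"
    proof (intro equalityI subsetI)
      fix e assume "e \<in> map_prod \<phi> \<phi> ` extremal_arcs V L T"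
      then show "e \<in> extremal_arcs P S3_low S3_hub"
        using img by (auto simp: extremal_arcs_def inj low hub)
    next
      fix e assume "e \<in> extremal_arcs P S3_low S3_hub"
      moreover obtain p q where "e = (p, q)" by (cases e)
      ultimately obtain a b where "a \<in> V" "b \<in> V" "e = (\<phi> a, \<phi> b)" "(\<phi> a, \<phi> b) \<in> extremal_arcs P S3_low S3_hub"
        using img by (auto simp: extremal_arcs_def)
      then have "(a, b) \<in> extremal_arcs V L T" by (auto simp: extremal_arcs_def low hub)
      then show "e \<in> map_prod \<phi> \<phi> ` extremal_arcs V L T"
        using \<open>e = (\<phi> a, \<phi> b)\<close> by (auto intro: rev_image_eqI)
    qed
  qed
  then show thesis using that bij unfolding P_def parcs_S3[symmetric] by blast
qed

text \<open>
  The Rayleigh bound is transported along the isomorphism, so that functions on the vertices of another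
  graph can serve as test vectors for the extremal graph.
\<close>

lemma rayleigh_S3:
  assumes "finite V" "card V = n" "5 \<le> n" "L \<subseteq> V" "T \<subseteq> V" "L \<inter> T = {}" "card L = 2" "card T = 3"
  shows "(\<Sum>e\<in>extremal_arcs V L T. f (fst e) * f (snd e))
    \<le> graph_spectral_radius (S3 n) * (\<Sum>v\<in>V. (f v)\<^sup>2)"
proof -
  obtain \<phi> where bij: "bij_betw \<phi> V (pverts (S3 n))"
    and bij2: "bij_betw (map_prod \<phi> \<phi>) (extremal_arcs V L T) (parcs (S3 n))"
    using S3_isomorphic_copy[OF assms] .
  interpret S: simple_graph "pverts (S3 n)" "parcs (S3 n)"
    by (rule simple_graphI[OF pair_graph_S3])
  define g where "g = f \<circ> inv_into V \<phi>"
  have g: "g (\<phi> v) = f v" if "v \<in> V" for v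
    using that bij by (simp add: g_def bij_betw_def inv_into_f_f)
  have "pverts (S3 n) \<noteq> {}" using card_pverts_S3[OF assms(3)] assms(3) by auto
  then have ray: "S.adj_form g g \<le> graph_spectral_radius (S3 n) * (\<Sum>v\<in>pverts (S3 n). (g v)\<^sup>2)"
    using spectral_radius_perron_rayleigh[OF pair_graph_S3] by blast
  have "(\<Sum>v\<in>pverts (S3 n). (g v)\<^sup>2) = (\<Sum>v\<in>V. (g (\<phi> v))\<^sup>2)"
    by (rule sum.reindex_bij_betw[OF bij, symmetric])
  also have "\<dots> = (\<Sum>v\<in>V. (f v)\<^sup>2)" by (rule sum.cong) (auto simp: g)
  finally have sq: "(\<Sum>v\<in>pverts (S3 n). (g v)\<^sup>2) = (\<Sum>v\<in>V. (f v)\<^sup>2)" .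
  have "S.adj_form g g = (\<Sum>e\<in>extremal_arcs V L T. g (fst (map_prod \<phi> \<phi> e)) * g (snd (map_prod \<phi> \<phi> e)))"
    unfolding S.adj_form_def by (rule sum.reindex_bij_betw[OF bij2, symmetric])
  also have "\<dots> = (\<Sum>e\<in>extremal_arcs V L T. f (fst e) * f (snd e))"
    by (rule sum.cong) (auto simp: extremal_arcs_def g)
  finally show ?thesis using ray sq by simp
qed

text \<open>
  The value \<open>n - 3\<close> comes from the clique on the complement of \<open>L\<close>. Giving the two remaining vertices a
  small weight \<open>\<epsilon>\<close> adds \<open>12 \<epsilon>\<close> to the form and only \<open>2 \<epsilon>\<^sup>2\<close> to the squared norm, so \<open>\<epsilon> = 1/n\<close> makes
  the quotient larger than \<open>n - 3\<close>.
\<close>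

lemma spectral_radius_S3_gt:
  assumes n: "5 \<le> n"
  shows "real n - 3 < graph_spectral_radius (S3 n)"
proof -
  define V where "V = {..<n}"
  define L where "L = {0, 1 :: nat}"
  define T where "T = {2, 3, 4 :: nat}"
  have parts: "finite V" "card V = n" "L \<subseteq> V" "T \<subseteq> V" "L \<inter> T = {}" "card L = 2" "card T = 3"
    using n by (auto simp: V_def L_def T_def)
  define f where "f v = (if v \<in> L then 1 / real n else 1)" for v
  interpret S: simple_graph V "extremal_arcs V L T" by (rule simple_graph_extremal[OF parts(1)])
  have finite_sets: "finite L" "finite T" "finite (V - L)" using parts by (auto simp: L_def T_def)
  have n0: "real n > 0" using n by simp
  have cVL: "card (V - L) = n - 2" using parts finite_sets by (simp add: card_Diff_subset)
  have low: "S.adj_sum f v = 3" if "v \<in> L" for v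
  proof -
    have "extremal_arcs V L T `` {v} = T"
      using that parts by (auto simp: extremal_arcs_def)
    moreover have "(\<Sum>w\<in>T. f w) = (\<Sum>w\<in>T. 1)"
      using parts(5) by (intro sum.cong) (auto simp: f_def)
    ultimately show ?thesis unfolding S.adj_sum_def using parts by simp
  qed
  have rest: "S.adj_sum f v = real n - 3 + (if v \<in> T then 2 / real n else 0)" if v: "v \<in> V - L" for v
  proof -
    have "extremal_arcs V L T `` {v} = (V - L - {v}) \<union> (if v \<in> T then L else {})"
      using v parts by (auto simp: extremal_arcs_def)
    moreover have "(\<Sum>w\<in>(V - L - {v}) \<union> (if v \<in> T then L else {}). f w)
        = (\<Sum>w\<in>V - L - {v}. f w) + (\<Sum>w\<in>(if v \<in> T then L else {}). f w)"
      using finite_sets by (intro sum.union_disjoint) auto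
    moreover have "(\<Sum>w\<in>V - L - {v}. f w) = (\<Sum>w\<in>V - L - {v}. 1)"
      by (intro sum.cong) (auto simp: f_def)
    moreover have "card (V - L - {v}) = n - 3" using v cVL finite_sets by simp
    moreover have "(\<Sum>w\<in>L. f w) = 2 / real n" using parts by (simp add: f_def)
    ultimately show ?thesis unfolding S.adj_sum_def using n by (auto simp: of_nat_diff)
  qed
  have "S.adj_form f f = (\<Sum>v\<in>V - L. f v * S.adj_sum f v) + (\<Sum>v\<in>L. f v * S.adj_sum f v)"
    unfolding S.adj_form_eq using parts by (intro sum.subset_diff) auto
  also have "(\<Sum>v\<in>L. f v * S.adj_sum f v) = (\<Sum>v\<in>L. 3 / real n)"
    by (rule sum.cong) (auto simp: low f_def)
  also have "\<dots> = 6 / real n" using parts by simp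
  also have "(\<Sum>v\<in>V - L. f v * S.adj_sum f v)
      = (\<Sum>v\<in>V - L. real n - 3) + (\<Sum>v\<in>V - L. if v \<in> T then 2 / real n else 0)"
    unfolding sum.distrib[symmetric] by (rule sum.cong) (auto simp: rest f_def)
  also have "(\<Sum>v\<in>V - L. if v \<in> T then 2 / real n else 0) = (\<Sum>v\<in>T. 2 / real n)"
    using parts finite_sets by (intro sum.mono_neutral_cong_right) auto
  also have "\<dots> = 6 / real n" using parts by simp
  also have "(\<Sum>v\<in>V - L. real n - 3) = (real n - 2) * (real n - 3)"
    using cVL n by (simp add: of_nat_diff)
  finally have form: "S.adj_form f f = (real n - 2) * (real n - 3) + 12 / real n" by simp
  have "(\<Sum>v\<in>V. (f v)\<^sup>2) = (\<Sum>v\<in>V - L. (f v)\<^sup>2) + (\<Sum>v\<in>L. (f v)\<^sup>2)"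
    using parts by (intro sum.subset_diff) auto
  also have "(\<Sum>v\<in>L. (f v)\<^sup>2) = (\<Sum>v\<in>L. (1 / real n)\<^sup>2)" by (rule sum.cong) (auto simp: f_def)
  also have "\<dots> = 2 / (real n)\<^sup>2" using parts by (simp add: power_divide)
  also have "(\<Sum>v\<in>V - L. (f v)\<^sup>2) = (\<Sum>v\<in>V - L. 1)" by (rule sum.cong) (auto simp: f_def)
  also have "\<dots> = real n - 2" using cVL n by (simp add: of_nat_diff)
  finally have sq: "(\<Sum>v\<in>V. (f v)\<^sup>2) = real n - 2 + 2 / (real n)\<^sup>2" .
  have pos: "0 < (\<Sum>v\<in>V. (f v)\<^sup>2)" unfolding sq using n by (simp add: add_pos_pos)
  have "(real n - 3) * (2 / (real n)\<^sup>2) < 12 / real n"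
    using n by (simp add: divide_simps power2_eq_square)
  then have "(real n - 3) * (\<Sum>v\<in>V. (f v)\<^sup>2) < S.adj_form f f"
    unfolding sq form by (simp add: distrib_left mult.commute)
  also have "\<dots> \<le> graph_spectral_radius (S3 n) * (\<Sum>v\<in>V. (f v)\<^sup>2)"
    unfolding S.adj_form_def by (rule rayleigh_S3[OF parts(1,2) n parts(3-7)])
  finally show ?thesis using pos by simp
qed

section \<open>Comparison with the extremal graph\<close>

lemma graph_iso_if_bij:
  assumes G: "pair_graph G" and \<phi>: "bij_betw \<phi> (pverts G) (pverts H)"
    and arcs: "map_prod \<phi> \<phi> ` parcs G = parcs H"
  shows "graph_iso G H"
proof -
  interpret pair_graph G by (rule G)
  define f where "f = \<lparr>iso_verts = \<phi>, iso_arcs = map_prod \<phi> \<phi>, iso_head = snd, iso_tail = fst\<rparr>"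
  have inj: "inj_on \<phi> (pverts G)" and img: "\<phi> ` pverts G = pverts H"
    using \<phi> by (auto simp: bij_betw_def)
  have "parcs G \<subseteq> pverts G \<times> pverts G" using G by (simp add: pair_graph_iff)
  then have "inj_on (map_prod \<phi> \<phi>) (parcs G)"
    by (rule inj_on_subset[OF map_prod_inj_on[OF inj inj]])
  then have "pre_digraph.digraph_isomorphism (with_proj G) f"
    using inj wf_digraph_axioms
    by (simp add: pre_digraph.digraph_isomorphism_def f_def)
  moreover have "with_proj H = app_iso f (with_proj G)"
    using img arcs by (simp add: with_proj_def app_iso_def f_def)
  ultimately show ?thesis unfolding graph_iso_def digraph_iso_def by blast
qed

lemma min_degree_le_deg:
  assumes G: "pair_graph G" and v: "v \<in> pverts G"
  shows "min_degree G \<le> simple_graph.deg (parcs G) v"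
proof -
  interpret G: simple_graph "pverts G" "parcs G" by (rule simple_graphI[OF G])
  have "out_arcs (with_proj G) v = Pair v ` (parcs G `` {v})"
    by (auto simp: out_arcs_def)
  then have "out_degree (with_proj G) v = G.deg v"
    unfolding out_degree_def G.deg_def by (simp add: card_image inj_on_def)
  then show ?thesis
    unfolding min_degree_def using v G.finite_V by (metis Min_le finite_imageI imageI)
qed

lemma connected_rtrancl:
  assumes G: "pair_graph G" and conn: "Digraph_Component.connected (with_proj G)"
    and "u \<in> pverts G" "v \<in> pverts G"
  shows "(u, v) \<in> (parcs G)\<^sup>*"
proof -
  interpret G: simple_graph "pverts G" "parcs G" by (rule simple_graphI[OF G])
  have "parcs (mk_symmetric (with_proj G)) = parcs G"
    using G.arc_sym by (fastforce simp: parcs_mk_symmetric)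
  moreover have "reachable (with_proj (mk_symmetric (with_proj G))) u v"
    using conn assms(3,4) by (simp add: connected_def strongly_connected_def)
  ultimately have "(u, v) \<in> rtrancl_on (pverts G) (parcs G)"
    by (simp add: reachable_def)
  then show ?thesis by (rule rtrancl_on_rtranclI)
qed

text \<open>
  The situation of the theorem, with \<open>x\<close> the Perron vector of \<open>G\<close>. As the spectral radius of the extremal
  graph is at most \<open>\<rho>\<close>, no copy of it on the same vertices gives \<open>x\<close> a larger value of the quadratic
  form than \<open>G\<close> does.
\<close>

locale spectral_extremal = simple_graph +
  fixes \<rho> :: real and x :: "'a \<Rightarrow> real"
  assumes x_pos: "v \<in> V \<Longrightarrow> 0 < x v"
    and eig: "v \<in> V \<Longrightarrow> adj_sum x v = \<rho> * x v"
    and card_V_ge: "14 \<le> card V"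
    and radius_le: "graph_spectral_radius (S3 (card V)) \<le> \<rho>"
begin

lemma adj_form_eigenvector: "adj_form x x = \<rho> * (\<Sum>v\<in>V. (x v)\<^sup>2)"
  unfolding adj_form_eq sum_distrib_left
  by (rule sum.cong) (auto simp: eig power2_eq_square)

lemma extremal_form_le:
  assumes "L \<subseteq> V" "T \<subseteq> V" "L \<inter> T = {}" "card L = 2" "card T = 3"
  shows "(\<Sum>e\<in>extremal_arcs V L T. x (fst e) * x (snd e)) \<le> adj_form x x"
proof -
  have "(\<Sum>e\<in>extremal_arcs V L T. x (fst e) * x (snd e))
      \<le> graph_spectral_radius (S3 (card V)) * (\<Sum>v\<in>V. (x v)\<^sup>2)"
    using card_V_ge by (intro rayleigh_S3[OF finite_V refl _ assms]) simp
  also have "\<dots> \<le> \<rho> * (\<Sum>v\<in>V. (x v)\<^sup>2)"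
    using radius_le by (intro mult_right_mono sum_nonneg) auto
  finally show ?thesis by (simp add: adj_form_eigenvector)
qed

text \<open>
  Since \<open>x\<close> is positive, any missing arc would make the form of the copy strictly larger than that of the
  graph itself.
\<close>

lemma arcs_eq_extremal:
  assumes "L \<subseteq> V" "T \<subseteq> V" "L \<inter> T = {}" "card L = 2" "card T = 3"
    and sub: "E \<subseteq> extremal_arcs V L T"
  shows "E = extremal_arcs V L T"
proof (rule ccontr)
  let ?F = "extremal_arcs V L T"
  assume "E \<noteq> ?F"
  then obtain e where e: "e \<in> ?F - E" using sub by auto
  have FV: "?F \<subseteq> V \<times> V" by (auto simp: extremal_arcs_def)
  then have fin: "finite ?F" using finite_V by (meson finite_SigmaI finite_subset)
  have pos: "0 < x (fst e) * x (snd e)" if "e \<in> ?F" for e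
    using that FV x_pos by auto
  have "(\<Sum>e\<in>?F. x (fst e) * x (snd e))
      = (\<Sum>e\<in>?F - E. x (fst e) * x (snd e)) + adj_form x x"
    unfolding adj_form_def by (rule sum.subset_diff[OF sub fin])
  moreover have "0 < (\<Sum>e\<in>?F - E. x (fst e) * x (snd e))"
    using fin e pos by (intro sum_pos) auto
  ultimately show False using extremal_form_le[OF assms(1-5)] by simp
qed

text \<open>
  Trading the edge \<open>uw\<close> for edges from \<open>u\<close> and \<open>w\<close> to a vertex \<open>c\<close> leads into a copy of the extremal
  graph whose triangle is \<open>a\<close>, \<open>b\<close>, \<open>c\<close>, and changes the form by twice \<open>x c * (x u + x w) - x u * x w\<close>. If
  this were non-positive for all \<open>c\<close>, the entries \<open>x c\<close> would be at most \<open>s/4\<close> with \<open>s = x u + x w\<close>. The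
  eigenvalue equations at \<open>u\<close>, \<open>w\<close> and at \<open>a\<close>, \<open>b\<close> would then bound \<open>s\<close> and \<open>t = x a + x b\<close> in terms of
  each other so tightly that \<open>(\<rho> - 1)\<^sup>2 \<le> n\<close>, which is impossible for \<open>\<rho> > n - 3\<close>.
\<close>

lemma no_attached_edge:
  assumes uwab: "u \<in> V" "w \<in> V" "a \<in> V" "b \<in> V" "distinct [u, w, a, b]"
    and nbr: "E `` {u} \<subseteq> {w, a, b}" "E `` {w} \<subseteq> {u, a, b}"
  shows False
proof -
  define R where "R = V - {u, w, a, b}"
  define s where "s = x u + x w"
  define t where "t = x a + x b"
  define m where "m = real (card V)"
  have pos: "0 < x u" "0 < x w" "0 < x a" "0 < x b" using x_pos uwab by auto
  have finR: "finite R" using finite_V by (simp add: R_def)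
  have four: "card {u, w, a, b} = 4" "{u, w, a, b} \<subseteq> V" using uwab by auto
  have cR: "card R = card V - 4"
    unfolding R_def using four by (simp add: card_Diff_subset)
  have cRm: "real (card R) = m - 4" using cR card_V_ge by (simp add: m_def)
  have \<rho>m: "m - 3 < \<rho>" using spectral_radius_S3_gt[of "card V"] card_V_ge radius_le by (simp add: m_def)
  have "\<exists>c\<in>R. x u * x w < x c * s"
  proof (rule ccontr)
    assume "\<not> ?thesis"
    then have le: "x c * s \<le> x u * x w" if "c \<in> R" for c using that by force
    have small: "x c \<le> s / 4" if "c \<in> R" for c
    proof -
      have "4 * (x u * x w) \<le> s * s"
        using sum_power2_ge_zero[of "x u - x w" 0] unfolding s_def
        by (simp add: power2_eq_square algebra_simps)
      then have "(4 * x c) * s \<le> s * s" using le[OF that] by linarith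
      then show ?thesis using pos by (simp add: s_def)
    qed
    have bound: "\<rho> * x v \<le> sum x B" if "v \<in> V" "E `` {v} \<subseteq> B" "B \<subseteq> V" for v B
    proof -
      have "adj_sum x v \<le> sum x B"
        unfolding adj_sum_def using that finite_V finite_subset x_pos less_imp_le
        by (intro sum_mono2) (auto intro!: less_imp_le[OF x_pos])
      then show ?thesis using eig that by simp
    qed
    \<comment> \<open>Eigenvalue equations at the two attached vertices, added up.\<close>
    have "\<rho> * x u \<le> x w + t" "\<rho> * x w \<le> x u + t"
      using bound[OF uwab(1) nbr(1)] bound[OF uwab(2) nbr(2)] uwab by (auto simp: t_def)
    then have s_le: "(\<rho> - 1) * s \<le> 2 * t" by (simp add: s_def algebra_simps)
    \<comment> \<open>At \<open>a\<close> and \<open>b\<close> the neighbours in \<open>R\<close> number at most \<open>n - 4\<close>, each of weight at most \<open>s / 4\<close>.\<close>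
    have "sum x R \<le> (\<Sum>c\<in>R. s / 4)" using small by (rule sum_mono)
    then have R_le: "sum x R \<le> (m - 4) * s / 4" using cRm by simp
    have "\<rho> * x a \<le> sum x ({u, w, b} \<union> R)"
      using nbhd_subset[of a] uwab by (intro bound) (auto simp: R_def)
    also have "\<dots> = s + x b + sum x R"
      using finR uwab by (subst sum.union_disjoint) (auto simp: R_def s_def)
    finally have a_le: "\<rho> * x a \<le> s + x b + sum x R" .
    have "\<rho> * x b \<le> sum x ({u, w, a} \<union> R)"
      using nbhd_subset[of b] uwab by (intro bound) (auto simp: R_def)
    also have "\<dots> = s + x a + sum x R"
      using finR uwab by (subst sum.union_disjoint) (auto simp: R_def s_def)
    finally have b_le: "\<rho> * x b \<le> s + x a + sum x R" .
    have "\<rho> * t \<le> 2 * s + t + 2 * sum x R"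
      using a_le b_le by (simp add: t_def algebra_simps)
    also have "\<dots> \<le> t + m * s / 2" using R_le by (simp add: algebra_simps)
    finally have t_le: "(\<rho> - 1) * t \<le> m * s / 2" by (simp add: algebra_simps)
    have m14: "14 \<le> m" using card_V_ge by (simp add: m_def)
    have "(m - 4) * (m - 4) * s \<le> (\<rho> - 1) * (\<rho> - 1) * s"
      using \<rho>m m14 pos by (intro mult_right_mono mult_mono) (auto simp: s_def)
    also have "\<dots> \<le> (\<rho> - 1) * (2 * t)"
      using s_le \<rho>m m14 by (simp add: mult.assoc mult_left_mono)
    also have "\<dots> \<le> m * s" using t_le by simp
    finally have "(m - 4) * (m - 4) \<le> m" using pos by (simp add: s_def)
    moreover have "10 * (m - 4) \<le> (m - 4) * (m - 4)" using m14 by (intro mult_right_mono) auto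
    ultimately have "10 * (m - 4) \<le> m" by (rule order_trans[rotated])
    then show False using m14 by simp
  qed
  then obtain c where c: "c \<in> R" "x u * x w < x c * s" by blast
  define F where "F = extremal_arcs V {u, w} {a, b, c}"
  have cV: "c \<in> V" "c \<notin> {u, w, a, b}" using c by (auto simp: R_def)
  have FV: "F \<subseteq> V \<times> V" by (auto simp: F_def extremal_arcs_def)
  then have finF: "finite F" using finite_V by (meson finite_SigmaI finite_subset)
  have cN: "(u, c) \<notin> E" "(w, c) \<notin> E" "(c, u) \<notin> E" "(c, w) \<notin> E"
    using nbr cV arc_sym by blast+
  define D where "D = E - {(u, w), (w, u)}"
  let ?g = "\<lambda>e. x (fst e) * x (snd e)"
  have disj: "D \<inter> {(u, c), (c, u), (w, c), (c, w)} = {}" using cN by (auto simp: D_def)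
  have nbrD: "q \<in> {a, b}" if "(p, q) \<in> D" "p \<in> {u, w}" for p q
    using that nbr by (auto simp: D_def)
  have "D \<subseteq> F"
  proof
    fix e assume e: "e \<in> D"
    obtain p q where pq: "e = (p, q)" by (cases e)
    have "p \<in> V" "q \<in> V" "p \<noteq> q" using e pq E_subset by (auto simp: D_def)
    moreover have "(p, q) \<in> D" "(q, p) \<in> D" using e pq arc_sym by (auto simp: D_def)
    ultimately show "e \<in> F" using nbrD by (auto simp: F_def extremal_arcs_def pq)
  qed
  moreover have "{(u, c), (c, u), (w, c), (c, w)} \<subseteq> F"
    using cV uwab by (auto simp: F_def extremal_arcs_def)
  ultimately have DF: "D \<union> {(u, c), (c, u), (w, c), (c, w)} \<subseteq> F" by blast
  have "adj_form x x \<le> sum ?g (D \<union> {(u, w), (w, u)})"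
    unfolding adj_form_def using finite_E uwab pos
    by (intro sum_mono2) (auto simp: D_def)
  also have "\<dots> = sum ?g D + 2 * (x u * x w)"
    using finite_E uwab by (subst sum.union_disjoint) (auto simp: D_def mult.commute)
  also have "\<dots> < sum ?g D + 2 * (x c * s)" using c by simp
  also have "\<dots> = sum ?g (D \<union> {(u, c), (c, u), (w, c), (c, w)})"
    using finite_E uwab cV disj
    by (subst sum.union_disjoint) (auto simp: D_def s_def algebra_simps)
  also have "\<dots> \<le> sum ?g F"
    using FV finF DF x_pos by (intro sum_mono2) (auto intro!: mult_nonneg_nonneg less_imp_le)
  also have "\<dots> \<le> adj_form x x"
    unfolding F_def using uwab cV by (intro extremal_form_le) auto
  finally show False by simp
qed

end

theorem corollary1p9:
  fixes G :: "'a pair_pre_digraph" and n :: nat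
  assumes "pair_graph G"
    and "Digraph_Component.connected (with_proj G)"
    and "card (pverts G) = n"
    and "n \<ge> 14"
    and "min_degree G \<ge> 3"
    and "graph_spectral_radius G \<ge> graph_spectral_radius (S3 n)"
  shows "\<not> graph_iso G (S3 n) \<longrightarrow> hamilton_connected G"
proof (rule impI, rule ccontr)
  assume not_iso: "\<not> graph_iso G (S3 n)" and "\<not> hamilton_connected G"
  then obtain y z where yz: "y \<in> pverts G" "z \<in> pverts G" "y \<noteq> z"
    and no_path: "\<And>p. \<not> spanning_path (pverts G) (parcs G) y p z"
    unfolding hamilton_connected_def hamilton_path_iff by blast
  define V where "V = pverts G"
  define E where "E = parcs G"
  define \<rho> where "\<rho> = graph_spectral_radius G"
  interpret G: simple_graph V E unfolding V_def E_def by (rule simple_graphI[OF assms(1)])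
  have cV: "card V = n" using assms(3) by (simp add: V_def)
  have \<delta>: "3 \<le> G.deg v" if "v \<in> V" for v
    using min_degree_le_deg[OF assms(1)] assms(5) that unfolding V_def E_def by fastforce
  obtain x where x: "\<And>v. 0 \<le> x v" "\<exists>v\<in>V. x v \<noteq> 0"
    and eig: "\<And>v. v \<in> V \<Longrightarrow> G.adj_sum x v = \<rho> * x v"
    using spectral_radius_perron_rayleigh[OF assms(1)] yz(1) unfolding V_def E_def \<rho>_def
    by (metis empty_iff)
  obtain v0 where v0: "v0 \<in> V" "x v0 \<noteq> 0" using x(2) by blast
  have conn: "(v0, v) \<in> E\<^sup>*" if "v \<in> V" for v
    using connected_rtrancl[OF assms(1,2)] v0(1) that unfolding V_def E_def by blast
  interpret spectral_extremal V E \<rho> x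
  proof unfold_locales
    show "0 < x v" if "v \<in> V" for v
      using G.eigenvector_pos[OF eig x(1) v0 conn that] .
    show "G.adj_sum x v = \<rho> * x v" if "v \<in> V" for v by (rule eig[OF that])
    show "14 \<le> card V" using assms(4) cV by simp
    show "graph_spectral_radius (S3 (card V)) \<le> \<rho>" using assms(6) cV by (simp add: \<rho>_def)
  qed
  have \<rho>_gt: "real n - 3 < \<rho>"
    using spectral_radius_S3_gt[of n] assms(4,6) by (simp add: \<rho>_def)
  define S where "S = (\<Sum>v\<in>V. G.deg v)"
  have n14: "14 \<le> real n" using assms(4) by simp
  have dense: "n\<^sup>2 + 14 \<le> S + 5 * n"
  proof -
    have "\<rho>\<^sup>2 - (real 3 - 1) * \<rho> \<le> real S - real 3 * (real (card V) - 1)"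
      unfolding S_def by (rule G.eigenvalue_edge_bound[OF eig x \<delta>])
    then have "\<rho>\<^sup>2 - 2 * \<rho> \<le> real S - 3 * (real n - 1)" by (simp add: cV)
    \<comment> \<open>The function \<open>\<rho> * (\<rho> - 2)\<close> increases, so the edge bound may be evaluated at \<open>n - 3\<close>.\<close>
    moreover have "(real n - 3) * (real n - 5) < \<rho> * (\<rho> - 2)"
      using \<rho>_gt n14 by (intro mult_strict_mono) auto
    ultimately have "(real n)\<^sup>2 + 12 < real S + 5 * real n"
      by (simp add: power2_eq_square algebra_simps)
    then have "real (n\<^sup>2 + 12) < real (S + 5 * n)" by simp
    then have "n\<^sup>2 + 12 < S + 5 * n" by (simp only: of_nat_less_iff)
    moreover have "even S" unfolding S_def by (rule G.even_sum_deg)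
    then have "even (S + 5 * n) \<longleftrightarrow> even n" "even (n\<^sup>2 + 13) \<longleftrightarrow> odd n" by simp_all
    then have "S + 5 * n \<noteq> n\<^sup>2 + 13" by metis
    ultimately show ?thesis by linarith
  qed
  obtain H where H: "simple_graph V H" "E \<subseteq> H" "\<And>p. \<not> spanning_path V H y p z"
    and ore: "\<And>u v. u \<in> V \<Longrightarrow> v \<in> V \<Longrightarrow> u \<noteq> v \<Longrightarrow> (u, v) \<notin> H
      \<Longrightarrow> simple_graph.deg H u + simple_graph.deg H v \<le> card V"
    using G.saturated_supergraph[of y z] no_path unfolding V_def E_def by metis
  interpret H: simple_graph V H by (rule H(1))
  have degH: "G.deg v \<le> H.deg v" for v
    unfolding G.deg_def H.deg_def using H.finite_nbhd H(2) by (intro card_mono) auto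
  have incomplete: "\<exists>u\<in>V. \<exists>v\<in>V. u \<noteq> v \<and> (u, v) \<notin> H"
    using H.spanning_path_complete[of y z] H(3) yz unfolding V_def by blast
  have "(\<exists>u\<in>V. \<exists>w\<in>V. u \<noteq> w \<and> H.deg u \<le> 3 \<and> H.deg w \<le> 3)
      \<or> (card V = 14 \<and> S = 140 \<and> (\<forall>v\<in>V. 7 \<le> G.deg v))"
    unfolding S_def
    by (rule H.dense_nonadjacent_low_degrees[OF degH \<delta> _ _ ore incomplete])
      (use dense assms(4) cV in \<open>simp_all add: S_def\<close>)
  then show False
  proof
    assume *: "card V = 14 \<and> S = 140 \<and> (\<forall>v\<in>V. 7 \<le> G.deg v)"
    have "\<rho>\<^sup>2 - (real 7 - 1) * \<rho> \<le> real S - real 7 * (real (card V) - 1)"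
      unfolding S_def using * by (intro G.eigenvalue_edge_bound[OF eig x]) auto
    then have "\<rho> * (\<rho> - 6) \<le> 49" using * by (simp add: power2_eq_square algebra_simps)
    moreover have "11 * 5 < \<rho> * (\<rho> - 6)"
      using \<rho>_gt * cV by (intro mult_strict_mono) auto
    ultimately show False by simp
  next
    assume "\<exists>u\<in>V. \<exists>w\<in>V. u \<noteq> w \<and> H.deg u \<le> 3 \<and> H.deg w \<le> 3"
    then obtain u w where uw: "u \<in> V" "w \<in> V" "u \<noteq> w" "H.deg u \<le> 3" "H.deg w \<le> 3" by blast
    have deg3: "H.deg u = 3" "H.deg w = 3" using uw \<delta> degH le_antisym le_trans by metis+
    have "S \<le> (\<Sum>v\<in>V. H.deg v)" unfolding S_def by (rule sum_mono) (rule degH)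
    then have dense': "(card V)\<^sup>2 + 14 \<le> (\<Sum>v\<in>V. H.deg v) + 5 * card V"
      using dense unfolding cV by linarith
    have clique: "(a, b) \<in> H" if "a \<in> V - {u, w}" "b \<in> V - {u, w}" "a \<noteq> b" for a b
      using H.clique_off_two_low_vertices[OF dense' _ ore uw that] assms(4) cV by simp
    have clique': "(a, b) \<in> H" if "a \<in> V - {w, u}" "b \<in> V - {w, u}" "a \<noteq> b" for a b
      using clique that by auto
    have wu: "(a, u) \<in> H" if "a \<noteq> u" "(a, w) \<in> H" for a
      by (rule H.low_vertices_share_neighbours[OF clique ore uw(1-3) _ that]) (simp_all add: deg3)
    have uw': "(a, w) \<in> H" if "a \<noteq> w" "(a, u) \<in> H" for a
      by (rule H.low_vertices_share_neighbours[OF clique' ore uw(2,1) uw(3)[symmetric] _ that])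
        (simp_all add: deg3)
    show False
    proof (cases "(u, w) \<in> H")
      case False
      define T where "T = H `` {u}"
      have T: "card T = 3" "T \<subseteq> V" "{u, w} \<inter> T = {}"
        using deg3 H.nbhd_subset False by (auto simp: T_def H.deg_def)
      have "H `` {w} \<subseteq> T"
      proof
        fix c assume "c \<in> H `` {w}"
        then have "(c, w) \<in> H" "c \<noteq> u" using H.arc_sym False by auto
        then show "c \<in> T" using wu H.arc_sym by (auto simp: T_def)
      qed
      have nbr: "q \<in> T" if "(p, q) \<in> H" "p \<in> {u, w}" for p q
        using that \<open>H `` {w} \<subseteq> T\<close> by (auto simp: T_def)
      have "H \<subseteq> extremal_arcs V {u, w} T"
      proof
        fix e assume e: "e \<in> H"
        obtain p q where pq: "e = (p, q)" by (cases e)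
        have "p \<in> V" "q \<in> V" "p \<noteq> q" using e pq H.E_subset by auto
        moreover have "(p, q) \<in> H" "(q, p) \<in> H" using e pq H.arc_sym by auto
        ultimately show "e \<in> extremal_arcs V {u, w} T"
          using nbr by (simp add: extremal_arcs_def pq)
      qed
      then have "E \<subseteq> extremal_arcs V {u, w} T" using H(2) by blast
      then have eq: "E = extremal_arcs V {u, w} T"
        using uw T by (intro arcs_eq_extremal) auto
      obtain \<phi> where \<phi>: "bij_betw \<phi> V (pverts (S3 n))"
        and "bij_betw (map_prod \<phi> \<phi>) (extremal_arcs V {u, w} T) (parcs (S3 n))"
        using S3_isomorphic_copy[OF G.finite_V cV, of "{u, w}" T] uw T assms(4) by auto
      then have "map_prod \<phi> \<phi> ` parcs G = parcs (S3 n)"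
        unfolding eq[symmetric] E_def by (simp add: bij_betw_def)
      then have "graph_iso G (S3 n)"
        by (rule graph_iso_if_bij[OF assms(1) \<phi>[unfolded V_def]])
      then show False using not_iso by simp
    next
      case True
      have "card (H `` {u} - {w}) = 2"
        using deg3 True H.finite_nbhd by (simp add: H.deg_def)
      then obtain a b where ab: "H `` {u} - {w} = {a, b}" "a \<noteq> b" by (meson card_2_iff)
      have "a \<in> H `` {u} - {w}" "b \<in> H `` {u} - {w}" using ab by auto
      then have abV: "a \<in> V" "b \<in> V" "distinct [u, w, a, b]"
        using H.E_subset uw ab(2) by auto
      have "E `` {u} \<subseteq> {w, a, b}" using ab(1) H(2) by blast
      moreover have "E `` {w} \<subseteq> {u, a, b}"
      proof
        fix c assume "c \<in> E `` {w}"
        then have "(w, c) \<in> H" using H(2) by auto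
        then have "(c, w) \<in> H" "c \<noteq> w" using H.arc_sym by auto
        then have "c = u \<or> c \<in> H `` {u} - {w}" using wu[of c] H.arc_sym by blast
        then show "c \<in> {u, a, b}" using ab(1) by auto
      qed
      ultimately show False by (rule no_attached_edge[OF uw(1,2) abV])
    qed
  qed
qed

end
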